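(* Fix a prime power $q\ge2$ and reals $\gamma,\gamma'\ge1$ and $\alpha\in(0,1)$ with $\gamma'\le\frac{\gamma}{1+\alpha\gamma}$. There is a randomized algorithm which, for $m$ large enough, on input a $\gamma$-$\mathrm{NCP}_q$ instance $(G,\mathbf{t},k)$ with $G\in\mathbb{F}_q^{m\times n}$, $\mathbf{t}\in\mathbb{F}_q^m$, $k\in\mathbb{Z}^+$, together with a $(q,\alpha,d=\gamma k,N,m',n')$-locally dense code $(A,\mathbf{s})$ with $N\ge 100q^{10}(qm)^d$, outputs in time $\mathrm{poly}(m,m')$ an instance $(G_{\mathrm{final}},k')$ of $\gamma'$-$\mathrm{MDP}_q$ with $k'<\gamma k$ such that, with probability at least $0.99$: if $(G,\mathbf{t},k)$ is a YES instance of $\gamma$-$\mathrm{NCP}_q$ then $(G_{\mathrm{final}},k')$ is a YES instance of $\gamma'$-$\mathrm{MDP}_q$, and if $(G,\mathbf{t},k)$ is a NO instance of $\gamma$-$\mathrm{NCP}_q$ then $(G_{\mathrm{final}},k')$ is a NO instance of $\gamma'$-$\mathrm{MDP}_q$.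
   Context: For $G\in\mathbb{F}_q^{m\times n}$, $\mathcal{C}(G)=\{G\mathbf{x}:\mathbf{x}\in\mathbb{F}_q^n\}$. $\|\mathbf{v}\|_0$ is Hamming weight, $\lambda(\mathcal{C})$ the minimum weight of a nonzero codeword, $\mathrm{dist}(\mathbf{y},\mathcal{C})=\min_{\mathbf{c}\in\mathcal{C}}\|\mathbf{y}-\mathbf{c}\|_0$, and $\mathcal{B}_{q,m}(r)=\{\mathbf{x}\in\mathbb{F}_q^m:\|\mathbf{x}\|_0\le r\}$. $\gamma$-$\mathrm{NCP}_q$: given $G\in\mathbb{F}_q^{m\times n}$, $\mathbf{t}\in\mathbb{F}_q^m$, $k\in\mathbb{Z}^+$, YES if $\mathrm{dist}(\mathbf{t},\mathcal{C}(G))\le k$, NO if $\mathrm{dist}(\mathbf{t},\mathcal{C}(G))>\gamma k$. $\gamma$-$\mathrm{MDP}_q$: given $G$, $k$, YES if $\lambda(\mathcal{C}(G))\le k$, NO if $\lambda(\mathcal{C}(G))>\gamma k$. For $\alpha\in(0,1)$ and positive integers $d,N,m,n$, a $(q,\alpha,d,N,m,n)$-locally dense code is a pair $(A,\mathbf{s})$ with $A\in\mathbb{F}_q^{m\times n}$, $\mathbf{s}\in\mathbb{F}_q^m$, such that $\lambda(\mathcal{C}(A))>d$ and $|(\mathcal{C}(A)-\mathbf{s})\cap\mathcal{B}_{q,m}(\alpha d)|\ge N$.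
   Formalization: The time bound is poly(m,m')·(n+n'+1), not poly(m,m'), since with unboundedly many columns the input cannot be read in poly(m,m') time; for n,n' polynomial in m,m' they agree. The algorithm may evaluate ⌊c·x⌋ in one step for c among the fixed reals γ,γ',α. *)

theory Defs
  imports
    "HOL-Probability.Probability_Mass_Function"
    "HOL-Computational_Algebra.Polynomial"
    "Jordan_Normal_Form.Matrix"
begin

section \<open>Linear codes, NCP, MDP and locally dense codes\<close>

text \<open>
  The field with \<open>q\<close> elements is a type \<open>'a :: {field, finite}\<close>, so \<open>q = CARD('a)\<close>.
\<close>

definition code :: "'a :: field mat \<Rightarrow> 'a vec set" where
  "code G = {G *\<^sub>v x | x. x \<in> carrier_vec (dim_col G)}"

definition hamming_weight :: "'a :: zero vec \<Rightarrow> nat" where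
  "hamming_weight v = card {i. i < dim_vec v \<and> vec_index v i \<noteq> 0}"

text \<open>The code consisting of the zero word only has minimum distance \<open>\<infinity>\<close> (infimum of the empty set).\<close>

definition min_distance :: "'a :: zero vec set \<Rightarrow> ereal" where
  "min_distance C = (INF c \<in> {c \<in> C. c \<noteq> 0\<^sub>v (dim_vec c)}. ereal (real (hamming_weight c)))"

definition code_dist :: "'a :: field vec \<Rightarrow> 'a vec set \<Rightarrow> nat" where
  "code_dist y C = Min ((\<lambda>c. hamming_weight (y - c)) ` C)"

definition hamming_ball :: "nat \<Rightarrow> real \<Rightarrow> 'a :: zero vec set" where
  "hamming_ball m r = {x \<in> carrier_vec m. real (hamming_weight x) \<le> r}"

definition ncp_instance :: "nat \<Rightarrow> nat \<Rightarrow> 'a :: field mat \<Rightarrow> 'a vec \<Rightarrow> nat \<Rightarrow> bool" where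
  "ncp_instance m n G t k \<longleftrightarrow> G \<in> carrier_mat m n \<and> t \<in> carrier_vec m \<and> k > 0"

definition ncp_yes :: "'a :: field mat \<Rightarrow> 'a vec \<Rightarrow> nat \<Rightarrow> bool" where
  "ncp_yes G t k \<longleftrightarrow> code_dist t (code G) \<le> k"

definition ncp_no :: "real \<Rightarrow> 'a :: field mat \<Rightarrow> 'a vec \<Rightarrow> nat \<Rightarrow> bool" where
  "ncp_no \<gamma> G t k \<longleftrightarrow> real (code_dist t (code G)) > \<gamma> * real k"

definition mdp_yes :: "'a :: field mat \<Rightarrow> nat \<Rightarrow> bool" where
  "mdp_yes G k \<longleftrightarrow> min_distance (code G) \<le> ereal (real k)"

definition mdp_no :: "real \<Rightarrow> 'a :: field mat \<Rightarrow> nat \<Rightarrow> bool" where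
  "mdp_no \<gamma> G k \<longleftrightarrow> min_distance (code G) > ereal (\<gamma> * real k)"

definition locally_dense_code ::
  "real \<Rightarrow> nat \<Rightarrow> nat \<Rightarrow> nat \<Rightarrow> nat \<Rightarrow> 'a :: {field, finite} mat \<Rightarrow> 'a vec \<Rightarrow> bool" where
  "locally_dense_code \<alpha> d N m n A s \<longleftrightarrow>
     0 < \<alpha> \<and> \<alpha> < 1 \<and> 0 < d \<and> 0 < N \<and> 0 < m \<and> 0 < n \<and>
     A \<in> carrier_mat m n \<and> s \<in> carrier_vec m \<and>
     min_distance (code A) > ereal (real d) \<and>
     card ((\<lambda>c. c - s) ` code A \<inter> hamming_ball m (\<alpha> * real d)) \<ge> N"


section \<open>Randomized algorithms\<close>

text \<open>
  A randomized random-access machine over a fixed finite field \<open>'a\<close>, programmed in a small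
  structured language.  The store has natural-number variables and two-dimensional arrays of field
  elements.  A step is one assignment, one uniformly random draw of a field element, or one
  evaluation of a branching or loop condition.

  Numbers can be added and subtracted but not multiplied in one step, and a program is fixed
  independently of its input.  So after \<open>T\<close> steps every number has at most \<open>O(T)\<close> bits more than
  those of the input, and counting steps agrees with Turing machine time up to a polynomial
  (the field being fixed, its operations take constant time).

  The language has real constants \<open>c\<close>, which may be used only in \<open>Floor c e\<close>, with value
  \<open>\<lfloor>c \<cdot> e\<rfloor>\<close>.  This is how an algorithm depends on real parameters that are fixed in advance,
  which need not be computable; \<open>scalars_of P\<close> is the set of real constants occurring in \<open>P\<close>.
  For a rational \<open>c\<close> the operation can be computed in polynomial time.  Leaving these constants
  arbitrary would amount to advice, so a statement about a program has to restrict this set.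
\<close>

datatype (scalars_nexp: 'r) nexp =
    NConst nat
  | NVar string
  | NAdd "'r nexp" "'r nexp"
  | NSub "'r nexp" "'r nexp"
  | Floor 'r "'r nexp"

datatype (dead 'a, scalars_fexp: 'r) fexp =
    FConst 'a
  | Entry string "'r nexp" "'r nexp"
  | FAdd "('a, 'r) fexp" "('a, 'r) fexp"
  | FSub "('a, 'r) fexp" "('a, 'r) fexp"
  | FMul "('a, 'r) fexp" "('a, 'r) fexp"
  | FInv "('a, 'r) fexp"

datatype (dead 'a, scalars_bexp: 'r) bexp =
    Less "'r nexp" "'r nexp"
  | FEq "('a, 'r) fexp" "('a, 'r) fexp"
  | BNot "('a, 'r) bexp"
  | BAnd "('a, 'r) bexp" "('a, 'r) bexp"

datatype (dead 'a, scalars_com: 'r) com =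
    Assign string "'r nexp"
  | Store string "'r nexp" "'r nexp" "('a, 'r) fexp"
  | Draw string "'r nexp" "'r nexp"
  | Cond "('a, 'r) bexp" "('a, 'r) com list" "('a, 'r) com list"
  | While "('a, 'r) bexp" "('a, 'r) com list"

type_synonym 'a program = "('a, real) com list"

definition scalars_of :: "'a program \<Rightarrow> real set" where
  "scalars_of P = (\<Union>c \<in> set P. scalars_com c)"

record 'a store =
  num :: "string \<Rightarrow> nat"
  arr :: "string \<Rightarrow> nat \<Rightarrow> nat \<Rightarrow> 'a"

fun nval :: "real nexp \<Rightarrow> 'a store \<Rightarrow> nat" where
  "nval (NConst c) \<sigma> = c"
| "nval (NVar x) \<sigma> = num \<sigma> x"
| "nval (NAdd e f) \<sigma> = nval e \<sigma> + nval f \<sigma>"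
| "nval (NSub e f) \<sigma> = nval e \<sigma> - nval f \<sigma>"
| "nval (Floor c e) \<sigma> = nat \<lfloor>c * real (nval e \<sigma>)\<rfloor>"

fun fval :: "('a :: field, real) fexp \<Rightarrow> 'a store \<Rightarrow> 'a" where
  "fval (FConst c) \<sigma> = c"
| "fval (Entry M i j) \<sigma> = arr \<sigma> M (nval i \<sigma>) (nval j \<sigma>)"
| "fval (FAdd e f) \<sigma> = fval e \<sigma> + fval f \<sigma>"
| "fval (FSub e f) \<sigma> = fval e \<sigma> - fval f \<sigma>"
| "fval (FMul e f) \<sigma> = fval e \<sigma> * fval f \<sigma>"
| "fval (FInv e) \<sigma> = inverse (fval e \<sigma>)"

fun bval :: "('a :: field, real) bexp \<Rightarrow> 'a store \<Rightarrow> bool" where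
  "bval (Less e f) \<sigma> \<longleftrightarrow> nval e \<sigma> < nval f \<sigma>"
| "bval (FEq e f) \<sigma> \<longleftrightarrow> fval e \<sigma> = fval f \<sigma>"
| "bval (BNot b) \<sigma> \<longleftrightarrow> \<not> bval b \<sigma>"
| "bval (BAnd b c) \<sigma> \<longleftrightarrow> bval b \<sigma> \<and> bval c \<sigma>"

definition set_num :: "string \<Rightarrow> nat \<Rightarrow> 'a store \<Rightarrow> 'a store" where
  "set_num x v \<sigma> = \<sigma>\<lparr>num := (num \<sigma>)(x := v)\<rparr>"

definition set_entry :: "string \<Rightarrow> nat \<Rightarrow> nat \<Rightarrow> 'a \<Rightarrow> 'a store \<Rightarrow> 'a store" where
  "set_entry M i j v \<sigma> = \<sigma>\<lparr>arr := (arr \<sigma>)(M := (arr \<sigma> M)(i := (arr \<sigma> M i)(j := v)))\<rparr>"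

text \<open>A configuration is the remaining program together with the store; it has halted when the
  remaining program is empty.\<close>

type_synonym 'a config = "'a program \<times> 'a store"

fun step :: "'a :: {field, finite} config \<Rightarrow> 'a config pmf" where
  "step ([], \<sigma>) = return_pmf ([], \<sigma>)"
| "step (Assign x e # R, \<sigma>) = return_pmf (R, set_num x (nval e \<sigma>) \<sigma>)"
| "step (Store M i j e # R, \<sigma>) =
     return_pmf (R, set_entry M (nval i \<sigma>) (nval j \<sigma>) (fval e \<sigma>) \<sigma>)"
| "step (Draw M i j # R, \<sigma>) =
     map_pmf (\<lambda>v. (R, set_entry M (nval i \<sigma>) (nval j \<sigma>) v \<sigma>)) (pmf_of_set UNIV)"
| "step (Cond b P Q # R, \<sigma>) = return_pmf ((if bval b \<sigma> then P else Q) @ R, \<sigma>)"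
| "step (While b P # R, \<sigma>) =
     return_pmf (if bval b \<sigma> then P @ While b P # R else R, \<sigma>)"

text \<open>The distribution of the configuration after \<open>T\<close> steps.\<close>

definition run :: "'a :: {field, finite} program \<Rightarrow> nat \<Rightarrow> 'a store \<Rightarrow> 'a config pmf" where
  "run P T \<sigma> = ((\<lambda>D. bind_pmf D step) ^^ T) (return_pmf (P, \<sigma>))"


section \<open>Input and output of the reduction\<close>

definition mat_entries :: "'a :: zero mat \<Rightarrow> nat \<Rightarrow> nat \<Rightarrow> 'a" where
  "mat_entries M i j = (if i < dim_row M \<and> j < dim_col M then index_mat M (i, j) else 0)"

definition vec_entries :: "'a :: zero vec \<Rightarrow> nat \<Rightarrow> nat \<Rightarrow> 'a" where
  "vec_entries v i j = (if i < dim_vec v \<and> j = 0 then vec_index v i else 0)"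

definition input_store ::
  "'a :: zero mat \<Rightarrow> 'a vec \<Rightarrow> nat \<Rightarrow> 'a mat \<Rightarrow> 'a vec \<Rightarrow> 'a store" where
  "input_store G t k A s =
     \<lparr>num = (\<lambda>_. 0)(''m'' := dim_row G, ''n'' := dim_col G, ''k'' := k,
                    ''m1'' := dim_row A, ''n1'' := dim_col A),
      arr = (\<lambda>_ _ _. 0)(''G'' := mat_entries G, ''t'' := vec_entries t,
                        ''A'' := mat_entries A, ''s'' := vec_entries s)\<rparr>"

definition output_mat :: "'a store \<Rightarrow> 'a mat" where
  "output_mat \<sigma> = Matrix.mat (num \<sigma> ''rows'') (num \<sigma> ''cols'') (\<lambda>(i, j). arr \<sigma> ''out'' i j)"

definition output_k :: "'a store \<Rightarrow> nat" where
  "output_k \<sigma> = num \<sigma> ''k_out''"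

text \<open>
  Unwritten array entries are 0, so the dimensions of the output matrix are bounded explicitly:
  writing the output down takes time as well.
\<close>

definition outputs_within :: "'a :: {field, finite} program \<Rightarrow> nat \<Rightarrow> 'a store \<Rightarrow> bool" where
  "outputs_within P T \<sigma>\<^sub>0 \<longleftrightarrow>
     (\<forall>(R, \<sigma>) \<in> set_pmf (run P T \<sigma>\<^sub>0).
        R = [] \<and> dim_row (output_mat \<sigma>) \<le> T \<and> dim_col (output_mat \<sigma>) \<le> T)"

end

theory Submission
  imports Defs "HOL-Probability.Product_PMF"
begin

text \<open>
  Words \<open>(G x + \<beta> t, A y + \<beta> s)\<close> with \<open>\<beta> \<noteq> 0\<close> are far from zero in the NO case, and those with \<open>\<beta> = 0\<close>
  and \<open>A y \<noteq> 0\<close> are heavy because \<open>A\<close> has large minimum distance.  The remaining light words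
  \<open>(G x, 0)\<close>, of which there are at most \<open>(q m)\<^sup>d\<close>, are excluded by random parity checks.  To avoid
  Gaussian elimination, each check is appended as \<open>d\<close> equal coordinates, so that violating one check
  already costs weight \<open>d\<close>.  With \<open>q\<^sup>r\<close> between \<open>100 (q m)\<^sup>d\<close> and \<open>N / 100\<close>, a union bound shows that \<open>r\<close>
  checks exclude all light words, while Chebyshev's inequality for pairwise independent events shows
  that they keep one of the \<open>N\<close> words of weight at most \<open>k + \<alpha> d\<close> present in the YES case.  The power
  \<open>(q m)\<^sup>d\<close> is computed exactly by repeated addition.

  The bound \<open>k' < \<gamma> k\<close> has to be strict also if \<open>\<gamma>' = 1\<close> and \<open>1 + \<alpha> \<gamma> = \<gamma>\<close>, when \<open>k + \<alpha> d = \<gamma> k\<close>.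
  Hence the output is the direct sum, over all \<open>c < m\<close>, of the code with coordinate \<open>c\<close> of the first
  part erased: the lightest word of the YES case loses one in some summand, so \<open>k'\<close> can be taken to
  be \<open>\<lfloor>\<alpha> d\<rfloor> + k - 1\<close>, whereas in the NO case weights stay at least \<open>d\<close>.
\<close>

section \<open>Reasoning about programs\<close>

definition steps :: "nat \<Rightarrow> 'a :: {field, finite} config \<Rightarrow> 'a config pmf" where
  "steps T c = ((\<lambda>D. bind_pmf D step) ^^ T) (return_pmf c)"

lemma run_eq_steps: "run P T \<sigma> = steps T (P, \<sigma>)"
  by (simp add: run_def steps_def)

lemma steps_0 [simp]: "steps 0 c = return_pmf c"
  by (simp add: steps_def)

text \<open>\<open>run\<close> appends each step at the end of a distribution. Writing the iterate
  as a single bind with the kernel \<open>steps T\<close> allows a run to be cut at any point, which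
  \<open>steps_add\<close> and \<open>steps_Suc\<close> exploit.\<close>

lemma funpow_bind_step: "((\<lambda>D. bind_pmf D step) ^^ T) D = bind_pmf D (steps T)"
proof (induction T)
  case 0
  have "steps 0 = return_pmf"
    by (rule ext) simp
  then show ?case
    by (simp add: bind_return_pmf')
next
  case (Suc T)
  then show ?case
    by (simp add: steps_def[abs_def] bind_assoc_pmf)
qed

lemma steps_add: "steps (S + T) c = bind_pmf (steps S c) (steps T)"
proof -
  have "steps (S + T) c = ((\<lambda>D. bind_pmf D step) ^^ T) (steps S c)"
    by (simp add: steps_def add.commute[of S T] funpow_add)
  then show ?thesis
    by (simp add: funpow_bind_step)
qed

lemma steps_Suc: "steps (Suc T) c = bind_pmf (step c) (steps T)"
  using steps_add[of 1 T c] by (simp add: steps_def bind_return_pmf)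

text \<open>Halted configurations are absorbing, so a run that stops early can be padded up to a
  common time bound.\<close>

lemma steps_halted [simp]: "steps T ([], \<sigma>) = return_pmf ([], \<sigma>)"
  by (induction T) (simp_all add: steps_Suc bind_return_pmf)

text \<open>A predicate for runs without draws: the reduction makes all its draws in a single loop, whose
  distribution is computed separately.\<close>

definition reach ::
  "'a :: {field, finite} program \<Rightarrow> 'a store \<Rightarrow> nat \<Rightarrow> ('a store \<Rightarrow> bool) \<Rightarrow> bool" where
  "reach P \<sigma> B J \<longleftrightarrow>
     (\<exists>T \<le> B. \<exists>\<sigma>'. J \<sigma>' \<and> (\<forall>R. steps T (P @ R, \<sigma>) = return_pmf (R, \<sigma>')))"

lemma reach_mono:
  assumes "reach P \<sigma> B I" and "B \<le> C" and "\<And>\<sigma>'. I \<sigma>' \<Longrightarrow> J \<sigma>'"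
  shows "reach P \<sigma> C J"
  using assms unfolding reach_def by (meson order_trans)

lemma reach_Nil: "J \<sigma> \<Longrightarrow> reach [] \<sigma> B J"
  unfolding reach_def by (rule exI[of _ 0]) auto

lemma reach_step:
  assumes "reach Q \<sigma>' B J" and "\<And>R. step (c # P @ R, \<sigma>) = return_pmf (Q @ R, \<sigma>')"
  shows "reach (c # P) \<sigma> (Suc B) J"
proof -
  obtain T \<sigma>'' where T: "T \<le> B" "J \<sigma>''" "\<And>R. steps T (Q @ R, \<sigma>') = return_pmf (R, \<sigma>'')"
    using assms(1) unfolding reach_def by blast
  have "steps (Suc T) ((c # P) @ R, \<sigma>) = return_pmf (R, \<sigma>'')" for R
    using assms(2)[of R] T(3)[of R] by (simp add: steps_Suc bind_return_pmf)
  then show ?thesis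
    unfolding reach_def using T(1,2) by (intro exI[of _ "Suc T"]) auto
qed

lemma reach_Assign:
  "reach P (set_num x (nval e \<sigma>) \<sigma>) B J \<Longrightarrow> reach (Assign x e # P) \<sigma> (Suc B) J"
  by (rule reach_step) auto

lemma reach_Store:
  "reach P (set_entry M (nval i \<sigma>) (nval j \<sigma>) (fval e \<sigma>) \<sigma>) B J \<Longrightarrow>
   reach (Store M i j e # P) \<sigma> (Suc B) J"
  by (rule reach_step) auto

lemma reach_Cond:
  "reach ((if bval b \<sigma> then P else Q) @ R) \<sigma> B J \<Longrightarrow> reach (Cond b P Q # R) \<sigma> (Suc B) J"
  by (rule reach_step) auto

lemma reach_append:
  assumes "reach P \<sigma> B I" and "\<And>\<sigma>'. I \<sigma>' \<Longrightarrow> reach Q \<sigma>' C J"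
  shows "reach (P @ Q) \<sigma> (B + C) J"
proof -
  obtain S \<sigma>' where S: "S \<le> B" "I \<sigma>'" "\<And>R. steps S (P @ R, \<sigma>) = return_pmf (R, \<sigma>')"
    using assms(1) unfolding reach_def by blast
  obtain T \<sigma>'' where T: "T \<le> C" "J \<sigma>''" "\<And>R. steps T (Q @ R, \<sigma>') = return_pmf (R, \<sigma>'')"
    using assms(2)[OF S(2)] unfolding reach_def by blast
  have "steps (S + T) ((P @ Q) @ R, \<sigma>) = return_pmf (R, \<sigma>'')" for R
    by (simp add: steps_add S(3) T(3) bind_return_pmf)
  then show ?thesis
    unfolding reach_def using S(1) T(1,2)
    by (intro exI[of _ "S + T"]) (auto intro: add_mono)
qed

text \<open>The invariant carries the iteration number, so the same induction gives termination
  after \<open>n - j\<close> rounds. Each round costs the body and one test; the final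
  \<open>+ 1\<close> is the failing test.\<close>

lemma reach_While:
  assumes body: "\<And>j \<sigma>. j < n \<Longrightarrow> Inv j \<sigma> \<Longrightarrow> bval b \<sigma> \<and> reach P \<sigma> B (Inv (Suc j))"
    and exit: "\<And>\<sigma>. Inv n \<sigma> \<Longrightarrow> \<not> bval b \<sigma>"
    and "j \<le> n" and "Inv j \<sigma>"
  shows "reach [While b P] \<sigma> ((n - j) * Suc B + 1) (Inv n)"
  using assms(3,4)
proof (induction "n - j" arbitrary: j \<sigma>)
  case 0
  then have "\<not> bval b \<sigma>" "Inv n \<sigma>"
    using exit by auto
  then have "reach [While b P] \<sigma> (Suc 0) (Inv n)"
    by (intro reach_step[of "[]"] reach_Nil) auto
  then show ?case
    using 0 by simp
next
  case (Suc l)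
  then have "j < n"
    by simp
  then have b: "bval b \<sigma>" "reach P \<sigma> B (Inv (Suc j))"
    using body Suc.prems by auto
  have "reach (P @ [While b P]) \<sigma> (B + ((n - Suc j) * Suc B + 1)) (Inv n)"
    using b(2)
  proof (rule reach_append)
    fix \<sigma>' assume "Inv (Suc j) \<sigma>'"
    then show "reach [While b P] \<sigma>' ((n - Suc j) * Suc B + 1) (Inv n)"
      using Suc by auto
  qed
  then have "reach [While b P] \<sigma> (Suc (B + ((n - Suc j) * Suc B + 1))) (Inv n)"
    using b(1) by (intro reach_step[of "P @ [While b P]"]) auto
  moreover have "n - j = Suc (n - Suc j)"
    using \<open>j < n\<close> by simp
  ultimately show ?case
    by (simp only: mult_Suc add_Suc add.assoc)
qed

section \<open>Counting loops\<close>

definition For :: "string \<Rightarrow> real nexp \<Rightarrow> 'a program \<Rightarrow> 'a program" where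
  "For x e P = [Assign x (NConst 0),
     While (Less (NVar x) e) (P @ [Assign x (NAdd (NVar x) (NConst 1))])]"

text \<open>\<open>frame\<close> is needed because the counter changes between two executions of the
  body, \<open>bound\<close> because the bound expression is evaluated anew at every test. Increment
  and test cost 2 per round; the initial assignment and the failing test cost another 2.\<close>

lemma reach_For:
  assumes init: "Inv 0 \<sigma>"
    and body: "\<And>j \<sigma>. j < n \<Longrightarrow> Inv j \<sigma> \<Longrightarrow> num \<sigma> x = j \<Longrightarrow>
        reach P \<sigma> B (\<lambda>\<sigma>'. Inv (Suc j) \<sigma>' \<and> num \<sigma>' x = j)"
    and bound: "\<And>j \<sigma>. Inv j \<sigma> \<Longrightarrow> nval e \<sigma> = n"
    and frame: "\<And>j v \<sigma>. Inv j \<sigma> \<Longrightarrow> Inv j (set_num x v \<sigma>)"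
  shows "reach (For x e P) \<sigma> (n * (B + 2) + 2) (Inv n)"
proof -
  let ?I = "\<lambda>j \<sigma>. Inv j \<sigma> \<and> num \<sigma> x = j"
  let ?b = "Less (NVar x) e"
  let ?P = "P @ [Assign x (NAdd (NVar x) (NConst 1))]"
  have "reach ?P \<sigma>' (B + Suc 0) (?I (Suc j))" if "j < n" "?I j \<sigma>'" for j \<sigma>'
    using body[of j \<sigma>'] that
    by (intro reach_append[where I = "\<lambda>\<sigma>'. Inv (Suc j) \<sigma>' \<and> num \<sigma>' x = j"] reach_Assign reach_Nil)
       (auto simp: frame, auto simp: set_num_def)
  then have "reach [While ?b ?P] (set_num x 0 \<sigma>) ((n - 0) * Suc (B + Suc 0) + 1) (?I n)"
    using init by (intro reach_While) (auto simp: bound frame, auto simp: set_num_def)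
  then have "reach (For x e P) \<sigma> (Suc ((n - 0) * Suc (B + Suc 0) + 1)) (?I n)"
    unfolding For_def by (intro reach_Assign) simp
  then show ?thesis
    by (rule reach_mono) auto
qed

lemma reach_Assign1: "J (set_num x (nval e \<sigma>) \<sigma>) \<Longrightarrow> reach [Assign x e] \<sigma> 1 J"
  using reach_Assign[OF reach_Nil] by fastforce

lemma reach_Assign2:
  assumes "J (set_num y (nval f (set_num x (nval e \<sigma>) \<sigma>)) (set_num x (nval e \<sigma>) \<sigma>))"
  shows "reach [Assign x e, Assign y f] \<sigma> 2 J"
  unfolding numeral_2_eq_2 using assms by (intro reach_Assign reach_Nil)

lemma reach_Store1:
  "J (set_entry M (nval i \<sigma>) (nval j \<sigma>) (fval e \<sigma>) \<sigma>) \<Longrightarrow> reach [Store M i j e] \<sigma> 1 J"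
  using reach_Store[OF reach_Nil] by fastforce

lemma num_set_num [simp]: "num (set_num x v \<sigma>) = (num \<sigma>)(x := v)"
  and arr_set_num [simp]: "arr (set_num x v \<sigma>) = arr \<sigma>"
  and num_set_entry [simp]: "num (set_entry M i j a \<sigma>) = num \<sigma>"
  and arr_set_entry [simp]:
    "arr (set_entry M i j a \<sigma>) = (arr \<sigma>)(M := (arr \<sigma> M)(i := (arr \<sigma> M i)(j := a)))"
  by (simp_all add: set_num_def set_entry_def)

section \<open>The loop of random draws\<close>

definition put_random :: "(nat \<Rightarrow> 'a :: zero) \<Rightarrow> 'a store \<Rightarrow> 'a store" where
  "put_random h \<sigma> = \<sigma>\<lparr>arr := (arr \<sigma>)(''H'' := \<lambda>i j. if j = 0 then h i else 0)\<rparr>"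

lemma num_put_random [simp]: "num (put_random h \<sigma>) = num \<sigma>"
  and arr_put_random [simp]:
    "arr (put_random h \<sigma>) = (arr \<sigma>)(''H'' := \<lambda>i j. if j = 0 then h i else 0)"
  by (simp_all add: put_random_def)

definition draw_loop :: "'a program" where
  "draw_loop = For ''z'' (NVar ''Z'') [Draw ''H'' (NVar ''z'') (NConst 0)]"

abbreviation uniform_fun :: "'i set \<Rightarrow> ('i \<Rightarrow> 'a :: {zero, finite}) pmf" where
  "uniform_fun I \<equiv> Pi_pmf I 0 (\<lambda>_. pmf_of_set UNIV)"

text \<open>The step count is exact, so that one product distribution describes the store at one
  time: every round consists of test, draw and increment, and the 2 accounts for the initial
  assignment and the failing test.\<close>

lemma steps_draw_loop:
  fixes \<sigma> :: "'a :: {field, finite} store"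
  assumes "arr \<sigma> ''H'' = (\<lambda>_ _. 0)"
  shows "steps (3 * num \<sigma> ''Z'' + 2) (draw_loop @ R, \<sigma>) =
    map_pmf (\<lambda>h. (R, put_random h (set_num ''z'' (num \<sigma> ''Z'') \<sigma>))) (uniform_fun {..<num \<sigma> ''Z''})"
proof -
  let ?W = "While (Less (NVar ''z'') (NVar ''Z''))
    ([Draw ''H'' (NVar ''z'') (NConst 0)] @ [Assign ''z'' (NAdd (NVar ''z'') (NConst 1))])
    :: ('a, real) com"
  let ?\<sigma> = "\<lambda>c h. put_random h (set_num ''z'' c \<sigma>)"
  \<comment> \<open>After \<open>c\<close> rounds the cells from \<open>c\<close> on are still 0,
    which is the default value of \<open>uniform_fun\<close>.\<close>
  have loop: "steps (3 * c) (?W # R, set_num ''z'' 0 \<sigma>) =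
      map_pmf (\<lambda>h. (?W # R, ?\<sigma> c h)) (uniform_fun {..<c})" if "c \<le> num \<sigma> ''Z''" for c
    using that
  proof (induction c)
    case 0
    have "put_random (\<lambda>_. 0) (set_num ''z'' 0 \<sigma>) = set_num ''z'' 0 \<sigma>"
      using assms by (simp add: put_random_def set_num_def fun_upd_idem)
    then show ?case
      by simp
  next
    case (Suc c)
    have upd: "set_num ''z'' (Suc c) (set_entry ''H'' c 0 v (?\<sigma> c h)) = ?\<sigma> (Suc c) (h(c := v))"
      for v h
      by (rule store.equality) (auto simp: fun_upd_def fun_eq_iff)
    have 3: "3 = Suc (Suc (Suc 0))"
      by simp
    have one: "steps 3 (?W # R, ?\<sigma> c h) =
        map_pmf (\<lambda>v. (?W # R, ?\<sigma> (Suc c) (h(c := v)))) (pmf_of_set UNIV)" for h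
      using Suc.prems unfolding 3
      by (simp add: steps_Suc bind_return_pmf map_pmf_def bind_assoc_pmf upd)
    have "steps (3 * Suc c) (?W # R, set_num ''z'' 0 \<sigma>) =
        bind_pmf (steps (3 * c) (?W # R, set_num ''z'' 0 \<sigma>)) (steps 3)"
      by (simp only: mult_Suc_right add.commute[of 3] steps_add)
    also have "\<dots> = bind_pmf (uniform_fun {..<c})
          (\<lambda>h. map_pmf (\<lambda>v. (?W # R, ?\<sigma> (Suc c) (h(c := v)))) (pmf_of_set UNIV))"
      using Suc by (simp only: bind_map_pmf one Suc_leD)
    \<comment> \<open>Inserting an index into a product distribution draws the new coordinate first,
      whereas the program draws it last; the two draws commute.\<close>
    also have "\<dots> = map_pmf (\<lambda>h. (?W # R, ?\<sigma> (Suc c) h)) (uniform_fun {..<Suc c})"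
      unfolding lessThan_Suc
      by (subst Pi_pmf_insert', simp, simp)
         (subst bind_commute_pmf, simp add: map_pmf_def bind_assoc_pmf bind_return_pmf)
    finally show ?case .
  qed
  have "steps 1 (draw_loop @ R, \<sigma>) = return_pmf (?W # R, set_num ''z'' 0 \<sigma>)"
    by (simp add: draw_loop_def For_def steps_Suc bind_return_pmf)
  moreover have "steps 1 (?W # R, ?\<sigma> (num \<sigma> ''Z'') h) = return_pmf (R, ?\<sigma> (num \<sigma> ''Z'') h)" for h
    by (simp add: steps_Suc bind_return_pmf put_random_def set_num_def)
  ultimately have "steps (1 + 3 * num \<sigma> ''Z'' + 1) (draw_loop @ R, \<sigma>) =
      map_pmf (\<lambda>h. (R, ?\<sigma> (num \<sigma> ''Z'') h)) (uniform_fun {..<num \<sigma> ''Z''})"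
    by (simp only: steps_add bind_return_pmf loop[OF order_refl] bind_map_pmf)
       (simp add: map_pmf_def)
  then show ?thesis
    by simp
qed

section \<open>The reduction\<close>

primrec nmul :: "nat \<Rightarrow> real nexp \<Rightarrow> real nexp" where
  "nmul 0 e = NConst 0"
| "nmul (Suc c) e = NAdd e (nmul c e)"

lemma nval_nmul [simp]: "nval (nmul c e) \<sigma> = c * nval e \<sigma>"
  by (induction c) simp_all

lemma scalars_nmul: "scalars_nexp (nmul c e) \<subseteq> scalars_nexp e"
  by (induction c) auto

text \<open>The logarithm of \<open>(q * m) ^ d\<close> to base \<open>q\<close>, rounded up.
  \<open>params_prog\<close> adds seven more checks, for a safety factor of
  \<open>q ^ 7\<close>.\<close>

definition hash_rank :: "nat \<Rightarrow> nat \<Rightarrow> nat \<Rightarrow> nat" where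
  "hash_rank q m d = (LEAST j. (q * m) ^ d \<le> q ^ j)"

text \<open>Each round of the outer loop multiplies \<open>X\<close> by \<open>q * m\<close> through
  \<open>m\<close> additions of \<open>q * X\<close>, where \<open>nmul q\<close> is an unrolled sum
  inside one expression. The \<open>While\<close> loop finds the logarithm, and the last loop
  multiplies \<open>r\<close> by the number of coefficients of a check.\<close>

definition params_prog :: "real \<Rightarrow> nat \<Rightarrow> 'a program" where
  "params_prog \<gamma> q =
     [Assign ''d'' (Floor \<gamma> (NVar ''k'')), Assign ''X'' (NConst 1)] @
     For ''c'' (NVar ''d'')
       ([Assign ''Y'' (NConst 0)] @
        For ''e'' (NVar ''m'') [Assign ''Y'' (NAdd (NVar ''Y'') (nmul q (NVar ''X'')))] @
        [Assign ''X'' (NVar ''Y'')]) @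
     [Assign ''p'' (NConst 1), Assign ''r'' (NConst 0)] @
     [While (Less (NVar ''p'') (NVar ''X''))
       [Assign ''p'' (nmul q (NVar ''p'')), Assign ''r'' (NAdd (NVar ''r'') (NConst 1))]] @
     [Assign ''r'' (NAdd (NVar ''r'') (NConst 7)), Assign ''Z'' (NConst 0)] @
     For ''l'' (NVar ''r'')
       [Assign ''Z'' (NAdd (NVar ''Z'') (NAdd (NAdd (NVar ''m'') (NVar ''m1'')) (NConst 1)))]"

definition dims :: "nat \<Rightarrow> nat \<Rightarrow> nat \<Rightarrow> nat \<Rightarrow> nat \<Rightarrow> 'a store \<Rightarrow> bool" where
  "dims m n k m' n' \<sigma> \<longleftrightarrow> num \<sigma> ''m'' = m \<and> num \<sigma> ''n'' = n \<and> num \<sigma> ''k'' = k \<and>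
     num \<sigma> ''m1'' = m' \<and> num \<sigma> ''n1'' = n'"

lemma power_ge_exists: "2 \<le> q \<Longrightarrow> \<exists>j. x \<le> q ^ j" for q x :: nat
  by (intro exI[of _ x] order_trans[OF less_imp_le[OF less_exp] power_mono]) auto

text \<open>Although \<open>X\<close> and \<open>p\<close> may become exponentially large, the step
  count depends only on the numbers of rounds, given by \<open>d\<close>, \<open>m\<close> and
  \<open>r\<close>.\<close>

lemma reach_params_prog:
  fixes \<sigma> :: "'a :: {field, finite} store" and \<gamma> :: real
  assumes "2 \<le> q" and dims: "dims m n k m' n' \<sigma>"
  defines "d \<equiv> nat \<lfloor>\<gamma> * real k\<rfloor>"
  defines "r \<equiv> hash_rank q m d + 7"
  shows "reach (params_prog \<gamma> q) \<sigma> (d * (3 * m + 6) + 6 * r + 10)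
    (\<lambda>\<sigma>'. dims m n k m' n' \<sigma>' \<and> arr \<sigma>' = arr \<sigma> \<and> num \<sigma>' ''d'' = d \<and> num \<sigma>' ''r'' = r \<and>
       num \<sigma>' ''Z'' = r * (m + m' + 1))"
proof -
  let ?I = "\<lambda>\<sigma>'. dims m n k m' n' \<sigma>' \<and> arr \<sigma>' = arr \<sigma> \<and> num \<sigma>' ''d'' = d"
  let ?X = "\<lambda>j \<sigma>'. ?I \<sigma>' \<and> num \<sigma>' ''X'' = (q * m) ^ j"
  let ?Y = "\<lambda>j i \<sigma>'. ?X j \<sigma>' \<and> num \<sigma>' ''c'' = j \<and> num \<sigma>' ''Y'' = i * (q * (q * m) ^ j)"
  let ?p = "\<lambda>j \<sigma>'. ?X d \<sigma>' \<and> num \<sigma>' ''p'' = q ^ j \<and> num \<sigma>' ''r'' = j"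
  let ?Z = "\<lambda>j \<sigma>'. ?I \<sigma>' \<and> num \<sigma>' ''r'' = r \<and> num \<sigma>' ''Z'' = j * (m + m' + 1)"
  let ?row = "[Assign ''Y'' (NAdd (NVar ''Y'') (nmul q (NVar ''X'')))] :: 'a program"
  let ?pow = "[Assign ''Y'' (NConst 0)] @ For ''e'' (NVar ''m'') ?row @ [Assign ''X'' (NVar ''Y'')]"
  have row: "reach (For ''e'' (NVar ''m'') ?row) \<sigma>' (m * (1 + 2) + 2) (?Y j m)"
    if "?Y j 0 \<sigma>'" for j \<sigma>'
    using that
    by (intro reach_For[where Inv = "?Y j"] reach_Assign1) (auto simp: dims_def algebra_simps)
  have pow: "reach ?pow \<sigma>' (3 * m + 4) (\<lambda>\<sigma>''. ?X (Suc j) \<sigma>'' \<and> num \<sigma>'' ''c'' = j)"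
    if "?X j \<sigma>'" "num \<sigma>' ''c'' = j" for j \<sigma>'
  proof -
    have "reach (For ''e'' (NVar ''m'') ?row @ [Assign ''X'' (NVar ''Y'')])
        (set_num ''Y'' 0 \<sigma>') ((m * (1 + 2) + 2) + Suc 0)
        (\<lambda>\<sigma>''. ?X (Suc j) \<sigma>'' \<and> num \<sigma>'' ''c'' = j)"
      using that
      by (intro reach_append[where I = "?Y j m"] row reach_Assign reach_Nil)
         (auto simp: dims_def algebra_simps)
    then have "reach ?pow \<sigma>' (Suc ((m * (1 + 2) + 2) + Suc 0))
        (\<lambda>\<sigma>''. ?X (Suc j) \<sigma>'' \<and> num \<sigma>'' ''c'' = j)"
      by (simp del: One_nat_def, intro reach_Assign) simp
    then show ?thesis
      by (rule reach_mono) auto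
  qed
  have power_loop: "reach (For ''c'' (NVar ''d'') ?pow) \<sigma>' (d * (3 * m + 4 + 2) + 2) (?X d)"
    if "?X 0 \<sigma>'" for \<sigma>'
    using that by (intro reach_For[where Inv = ?X] pow) (auto simp: dims_def)
  have log_loop: "reach [While (Less (NVar ''p'') (NVar ''X''))
       [Assign ''p'' (nmul q (NVar ''p'')), Assign ''r'' (NAdd (NVar ''r'') (NConst 1))]]
       \<sigma>' ((hash_rank q m d - 0) * Suc 2 + 1) (?p (hash_rank q m d))" if "?p 0 \<sigma>'" for \<sigma>'
    using that
  proof (intro reach_While[where Inv = ?p])
    \<comment> \<open>Minimality of \<open>hash_rank\<close> keeps the guard true in all earlier
      rounds; the inequality that defines it makes the guard fail at the end.\<close>
    fix j \<sigma>' assume "j < hash_rank q m d" "?p j \<sigma>'"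
    moreover from this have "q ^ j < (q * m) ^ d"
      unfolding hash_rank_def using not_less_Least by force
    ultimately show "bval (Less (NVar ''p'') (NVar ''X'')) \<sigma>' \<and>
        reach [Assign ''p'' (nmul q (NVar ''p'')), Assign ''r'' (NAdd (NVar ''r'') (NConst 1))]
          \<sigma>' 2 (?p (Suc j))"
      by (intro conjI reach_Assign2) (auto simp: dims_def)
  next
    fix \<sigma>' assume "?p (hash_rank q m d) \<sigma>'"
    moreover have "(q * m) ^ d \<le> q ^ hash_rank q m d"
      unfolding hash_rank_def by (rule LeastI_ex) (rule power_ge_exists[OF \<open>2 \<le> q\<close>])
    ultimately show "\<not> bval (Less (NVar ''p'') (NVar ''X'')) \<sigma>'"
      by auto
  qed auto
  have count: "reach (For ''l'' (NVar ''r'')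
      [Assign ''Z'' (NAdd (NVar ''Z'') (NAdd (NAdd (NVar ''m'') (NVar ''m1'')) (NConst 1)))])
      \<sigma>' (r * (1 + 2) + 2) (?Z r)" if "?Z 0 \<sigma>'" for \<sigma>'
    using that
    by (intro reach_For[where Inv = ?Z] reach_Assign1) (auto simp: dims_def algebra_simps)
  have "reach (params_prog \<gamma> q) \<sigma>
     (2 + ((d * (3 * m + 4 + 2) + 2) + (2 + (((hash_rank q m d - 0) * Suc 2 + 1) +
        (2 + (r * (1 + 2) + 2)))))) (?Z r)"
    unfolding params_prog_def
  proof (rule reach_append[where I = "?X 0"], goal_cases)
    case 1
    show ?case
      using dims by (intro reach_Assign2) (auto simp: dims_def d_def)
  next
    case (2 \<sigma>1)
    then show ?case
    proof (rule reach_append[OF power_loop], goal_cases)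
      case (1 \<sigma>2)
      show ?case
      proof (rule reach_append[where I = "?p 0"], goal_cases)
        case 1
        show ?case
          using \<open>?X d \<sigma>2\<close> by (intro reach_Assign2) (auto simp: dims_def)
      next
        case (2 \<sigma>3)
        then show ?case
        proof (rule reach_append[OF log_loop], goal_cases)
          case (1 \<sigma>4)
          show ?case
          proof (rule reach_append[where I = "?Z 0"], goal_cases)
            case 1
            show ?case
              using \<open>?p (hash_rank q m d) \<sigma>4\<close>
              by (intro reach_Assign2) (auto simp: dims_def r_def)
          next
            case (2 \<sigma>5)
            then show ?case
              by (rule count)
          qed
        qed
      qed
    qed
  qed
  then show ?thesis
    by (rule reach_mono) (auto simp: r_def algebra_simps)
qed

section \<open>Writing the stacked matrix\<close>

definition fill_rows ::
  "string \<Rightarrow> string \<Rightarrow> string \<Rightarrow> string \<Rightarrow> real nexp \<Rightarrow> real nexp \<Rightarrow> 'a program" where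
  "fill_rows x y E v ri ci =
     For ''i'' (NVar x)
       (For ''j'' (NVar y)
          [Store ''B'' (NAdd ri (NVar ''i'')) (NAdd ci (NVar ''j''))
             (Entry E (NVar ''i'') (NVar ''j''))] @
        [Store ''B'' (NAdd ri (NVar ''i'')) (NAdd (NVar ''n'') (NVar ''n1''))
           (Entry v (NVar ''i'') (NConst 0))])"

text \<open>\<open>z\<close> runs through the draws of all checks and is reset for every
  \<open>e\<close>, so the \<open>d\<close> copies of a check use the same coefficients and are
  equal rows.\<close>

definition hash_prog :: "'a program" where
  "hash_prog =
     [Assign ''R'' (NAdd (NVar ''m'') (NVar ''m1''))] @
     For ''e'' (NVar ''d'')
       ([Assign ''z'' (NConst 0)] @
        For ''l'' (NVar ''r'')
          (For ''i'' (NAdd (NVar ''m'') (NVar ''m1''))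
             (For ''j'' (NAdd (NAdd (NVar ''n'') (NVar ''n1'')) (NConst 1))
                [Store ''B'' (NVar ''R'') (NVar ''j'')
                   (FAdd (Entry ''B'' (NVar ''R'') (NVar ''j''))
                      (FMul (Entry ''H'' (NVar ''z'') (NConst 0))
                         (Entry ''B'' (NVar ''i'') (NVar ''j''))))] @
              [Assign ''z'' (NAdd (NVar ''z'') (NConst 1))]) @
           [Store ''B'' (NVar ''R'') (NAdd (NVar ''n'') (NVar ''n1''))
              (FAdd (Entry ''B'' (NVar ''R'') (NAdd (NVar ''n'') (NVar ''n1'')))
                 (Entry ''H'' (NVar ''z'') (NConst 0)))] @
           [Assign ''z'' (NAdd (NVar ''z'') (NConst 1)),
            Assign ''R'' (NAdd (NVar ''R'') (NConst 1))]))"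

text \<open>The block stacks the matrix with rows \<open>(G 0 t)\<close> and \<open>(0 A s)\<close> on top of \<open>d\<close> copies of \<open>r\<close>
  random combinations of these rows and of the last unit vector.  The column \<open>(t, s)\<close> carries a
  positive sign, which is harmless since codes are closed under negation.\<close>

locale reduction =
  fixes m n k m' n' d r :: nat
    and g t a s :: "nat \<Rightarrow> nat \<Rightarrow> 'a :: {field, finite}"
    and h :: "nat \<Rightarrow> 'a"
begin

abbreviation top_rows :: nat where "top_rows \<equiv> m + m'"

abbreviation block_cols :: nat where "block_cols \<equiv> n + n' + 1"

definition top_entry :: "nat \<Rightarrow> nat \<Rightarrow> 'a" where
  "top_entry i j =
     (if i < m then if j = n + n' then t i 0 else if j < n then g i j else 0
      else if i < top_rows then
        if j = n + n' then s (i - m) 0 else if n \<le> j \<and> j < n + n' then a (i - m) (j - n) else 0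
      else 0)"

text \<open>Every check consumes \<open>top_rows + 1\<close> consecutive draws. The last one acts on
  the coefficient of the column \<open>(t, s)\<close>; words in which this coefficient is 1 thus
  share a nonzero hashed coordinate, on which their pairwise independence rests.\<close>

definition hash_entry :: "nat \<Rightarrow> nat \<Rightarrow> 'a" where
  "hash_entry l j = (\<Sum>i<top_rows. h (l * (top_rows + 1) + i) * top_entry i j) +
     (if j = n + n' then h (l * (top_rows + 1) + top_rows) else 0)"

text \<open>\<open>L\<close> is the number of rows written so far, so the same function serves as
  the invariant of \<open>hash_prog\<close>. The remainder modulo \<open>r\<close> makes the check
  rows repeat with period \<open>r\<close>.\<close>

definition block_upto :: "nat \<Rightarrow> nat \<Rightarrow> nat \<Rightarrow> 'a" where
  "block_upto L i j =
     (if i < top_rows then top_entry i j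
      else if i < L \<and> j < block_cols then hash_entry ((i - top_rows) mod r) j else 0)"

abbreviation block_rows :: nat where "block_rows \<equiv> top_rows + d * r"

text \<open>The part of the store that stays fixed once the draws have been made.\<close>

definition ctx :: "'a store \<Rightarrow> bool" where
  "ctx \<sigma> \<longleftrightarrow> dims m n k m' n' \<sigma> \<and> num \<sigma> ''d'' = d \<and> num \<sigma> ''r'' = r \<and>
     arr \<sigma> ''G'' = g \<and> arr \<sigma> ''t'' = t \<and> arr \<sigma> ''A'' = a \<and> arr \<sigma> ''s'' = s \<and>
     arr \<sigma> ''H'' = (\<lambda>i j. if j = 0 then h i else 0)"

lemma ctx_set_num [simp]:
  "x \<notin> {''m'', ''n'', ''k'', ''m1'', ''n1'', ''d'', ''r''} \<Longrightarrow> ctx (set_num x v \<sigma>) = ctx \<sigma>"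
  by (auto simp: ctx_def dims_def)

lemma ctx_set_entry [simp]:
  "M \<notin> {''G'', ''t'', ''A'', ''s'', ''H''} \<Longrightarrow> ctx (set_entry M i j v \<sigma>) = ctx \<sigma>"
  by (auto simp: ctx_def dims_def)

lemma ctxD [simp]:
  assumes "ctx \<sigma>"
  shows "num \<sigma> ''m'' = m" "num \<sigma> ''n'' = n" "num \<sigma> ''k'' = k" "num \<sigma> ''m1'' = m'"
    "num \<sigma> ''n1'' = n'" "num \<sigma> ''d'' = d" "num \<sigma> ''r'' = r"
    "arr \<sigma> ''G'' = g" "arr \<sigma> ''t'' = t" "arr \<sigma> ''A'' = a" "arr \<sigma> ''s'' = s"
    "arr \<sigma> ''H'' = (\<lambda>i j. if j = 0 then h i else 0)"
  using assms by (auto simp: ctx_def dims_def)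

text \<open>Offsets and sources are arbitrary in order to cover both \<open>(G 0 t)\<close> and
  \<open>(0 A s)\<close>. The bound on \<open>col0 + Y\<close> keeps the matrix part clear of column
  \<open>n + n'\<close>, which receives the vector.\<close>

lemma reach_fill_rows:
  assumes row: "\<And>\<sigma>. ctx \<sigma> \<Longrightarrow> nval ri \<sigma> = row0"
    and col: "\<And>\<sigma>. ctx \<sigma> \<Longrightarrow> nval ci \<sigma> = col0"
    and x: "\<And>\<sigma>. ctx \<sigma> \<Longrightarrow> num \<sigma> x = X"
    and y: "\<And>\<sigma>. ctx \<sigma> \<Longrightarrow> num \<sigma> y = Y"
    and E: "\<And>\<sigma>. ctx \<sigma> \<Longrightarrow> arr \<sigma> E = b" and v: "\<And>\<sigma>. ctx \<sigma> \<Longrightarrow> arr \<sigma> v = w"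
    and "col0 + Y \<le> n + n'"
    and "ctx \<sigma>" and "arr \<sigma> ''B'' = b0"
  shows "reach (fill_rows x y E v ri ci) \<sigma> (X * (3 * Y + 5) + 2)
    (\<lambda>\<sigma>'. ctx \<sigma>' \<and> arr \<sigma>' ''out'' = arr \<sigma> ''out'' \<and> arr \<sigma>' ''B'' =
      (\<lambda>i j. if row0 \<le> i \<and> i < row0 + X then
         if j = n + n' then w (i - row0) 0
         else if col0 \<le> j \<and> j < col0 + Y then b (i - row0) (j - col0) else b0 i j
       else b0 i j))"
proof -
  let ?B = "\<lambda>x i j. if row0 \<le> i \<and> i < row0 + x then
         if j = n + n' then w (i - row0) 0
         else if col0 \<le> j \<and> j < col0 + Y then b (i - row0) (j - col0) else b0 i j
       else b0 i j"
  let ?I = "\<lambda>x \<sigma>'. ctx \<sigma>' \<and> arr \<sigma>' ''out'' = arr \<sigma> ''out'' \<and> arr \<sigma>' ''B'' = ?B x"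
  let ?J = "\<lambda>x y \<sigma>'. ctx \<sigma>' \<and> arr \<sigma>' ''out'' = arr \<sigma> ''out'' \<and> num \<sigma>' ''i'' = x \<and> arr \<sigma>' ''B'' =
    (?B x)(row0 + x := \<lambda>j. if col0 \<le> j \<and> j < col0 + y then b x (j - col0) else b0 (row0 + x) j)"
  have inner: "reach (For ''j'' (NVar y)
          [Store ''B'' (NAdd ri (NVar ''i'')) (NAdd ci (NVar ''j''))
             (Entry E (NVar ''i'') (NVar ''j''))]) \<sigma>' (Y * (1 + 2) + 2) (?J i Y)"
    if "?J i 0 \<sigma>'" for i \<sigma>'
    using that
    by (intro reach_For[where Inv = "?J i"] reach_Store1)
       (auto simp: row col y E fun_eq_iff)
  have outer: "reach (For ''i'' (NVar x)
       (For ''j'' (NVar y)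
          [Store ''B'' (NAdd ri (NVar ''i'')) (NAdd ci (NVar ''j''))
             (Entry E (NVar ''i'') (NVar ''j''))] @
        [Store ''B'' (NAdd ri (NVar ''i'')) (NAdd (NVar ''n'') (NVar ''n1''))
           (Entry v (NVar ''i'') (NConst 0))])) \<sigma> (X * ((Y * (1 + 2) + 2 + 1) + 2) + 2) (?I X)"
  proof (rule reach_For[where Inv = ?I])
    fix i \<sigma>' assume "i < X" "?I i \<sigma>'" "num \<sigma>' ''i'' = i"
    then show "reach (For ''j'' (NVar y)
          [Store ''B'' (NAdd ri (NVar ''i'')) (NAdd ci (NVar ''j''))
             (Entry E (NVar ''i'') (NVar ''j''))] @
        [Store ''B'' (NAdd ri (NVar ''i'')) (NAdd (NVar ''n'') (NVar ''n1''))
           (Entry v (NVar ''i'') (NConst 0))]) \<sigma>' (Y * (1 + 2) + 2 + 1)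
        (\<lambda>\<sigma>'. ?I (Suc i) \<sigma>' \<and> num \<sigma>' ''i'' = i)"
      using \<open>col0 + Y \<le> n + n'\<close>
      by (intro reach_append[where I = "?J i Y"] inner reach_Store1)
         (auto simp: row col v fun_eq_iff)
  qed (use \<open>ctx \<sigma>\<close> \<open>arr \<sigma> ''B'' = b0\<close> in \<open>auto simp: x fun_eq_iff\<close>)
  then show ?thesis
    unfolding fill_rows_def by (rule reach_mono) (auto simp: algebra_simps)
qed

lemma reach_hash_prog:
  assumes "ctx \<sigma>" and "arr \<sigma> ''B'' = block_upto top_rows"
  shows "reach hash_prog \<sigma> (d * (r * (top_rows * (3 * block_cols + 5) + 7) + 5) + 3)
    (\<lambda>\<sigma>'. ctx \<sigma>' \<and> arr \<sigma>' ''out'' = arr \<sigma> ''out'' \<and> num \<sigma>' ''R'' = block_rows \<and>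
       arr \<sigma>' ''B'' = block_upto block_rows)"
proof -
  let ?F = "\<lambda>\<sigma>'. ctx \<sigma>' \<and> arr \<sigma>' ''out'' = arr \<sigma> ''out''"
  let ?L = "\<lambda>e l. top_rows + (e * r + l)"
  let ?E = "\<lambda>e \<sigma>'. ?F \<sigma>' \<and> num \<sigma>' ''R'' = ?L e 0 \<and> arr \<sigma>' ''B'' = block_upto (?L e 0)"
  let ?I = "\<lambda>e l \<sigma>'. ?F \<sigma>' \<and> num \<sigma>' ''e'' = e \<and> num \<sigma>' ''R'' = ?L e l \<and>
    num \<sigma>' ''z'' = l * (top_rows + 1) \<and> arr \<sigma>' ''B'' = block_upto (?L e l)"
  let ?acc = "\<lambda>l i y. \<Sum>i'<i. h (l * (top_rows + 1) + i') * top_entry i' y"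
  let ?J = "\<lambda>e l i \<sigma>'. ?F \<sigma>' \<and> num \<sigma>' ''e'' = e \<and> num \<sigma>' ''l'' = l \<and> num \<sigma>' ''R'' = ?L e l \<and>
    num \<sigma>' ''z'' = l * (top_rows + 1) + i \<and> arr \<sigma>' ''B'' =
      (block_upto (?L e l))(?L e l := \<lambda>y. if y < block_cols then ?acc l i y else 0)"
  \<comment> \<open>In the row under construction, the summand of source row \<open>i\<close> has
    been added only in the columns below \<open>j\<close>.\<close>
  let ?K = "\<lambda>e l i j \<sigma>'. ?F \<sigma>' \<and> num \<sigma>' ''e'' = e \<and> num \<sigma>' ''l'' = l \<and> num \<sigma>' ''R'' = ?L e l \<and>
    num \<sigma>' ''z'' = l * (top_rows + 1) + i \<and> num \<sigma>' ''i'' = i \<and> arr \<sigma>' ''B'' =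
      (block_upto (?L e l))(?L e l := \<lambda>y. if y < block_cols then ?acc l i y +
          (if y < j then h (l * (top_rows + 1) + i) * top_entry i y else 0) else 0)"
  let ?PJ = "For ''j'' (NAdd (NAdd (NVar ''n'') (NVar ''n1'')) (NConst 1))
                [Store ''B'' (NVar ''R'') (NVar ''j'')
                   (FAdd (Entry ''B'' (NVar ''R'') (NVar ''j''))
                      (FMul (Entry ''H'' (NVar ''z'') (NConst 0))
                         (Entry ''B'' (NVar ''i'') (NVar ''j''))))] :: 'a program"
  let ?PI = "For ''i'' (NAdd (NVar ''m'') (NVar ''m1''))
             (?PJ @ [Assign ''z'' (NAdd (NVar ''z'') (NConst 1))])"
  let ?PL = "For ''l'' (NVar ''r'')
          (?PI @
           [Store ''B'' (NVar ''R'') (NAdd (NVar ''n'') (NVar ''n1''))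
              (FAdd (Entry ''B'' (NVar ''R'') (NAdd (NVar ''n'') (NVar ''n1'')))
                 (Entry ''H'' (NVar ''z'') (NConst 0)))] @
           [Assign ''z'' (NAdd (NVar ''z'') (NConst 1)),
            Assign ''R'' (NAdd (NVar ''R'') (NConst 1))])"
  have J: "reach ?PJ \<sigma>' (block_cols * (1 + 2) + 2) (?K e l i block_cols)"
    if "?K e l i 0 \<sigma>'" "i < top_rows" for e l i \<sigma>'
    using that
    by (intro reach_For[where Inv = "?K e l i"] reach_Store1)
       (auto simp: block_upto_def fun_eq_iff)
  have I: "reach ?PI \<sigma>' (top_rows * ((block_cols * (1 + 2) + 2 + 1) + 2) + 2) (?J e l top_rows)"
    if "?J e l 0 \<sigma>'" for e l \<sigma>'
  proof (rule reach_For[where Inv = "?J e l"])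
    fix i \<sigma>' assume "i < top_rows" "?J e l i \<sigma>'" "num \<sigma>' ''i'' = i"
    then show "reach (?PJ @ [Assign ''z'' (NAdd (NVar ''z'') (NConst 1))]) \<sigma>'
        (block_cols * (1 + 2) + 2 + 1) (\<lambda>\<sigma>'. ?J e l (Suc i) \<sigma>' \<and> num \<sigma>' ''i'' = i)"
      by (intro reach_append[where I = "?K e l i block_cols"] J reach_Assign1)
         (auto simp: fun_eq_iff)
  qed (use that in auto)
  have L: "reach ?PL \<sigma>' (r * ((top_rows * ((block_cols * (1 + 2) + 2 + 1) + 2) + 2 + (1 + 2)) + 2) + 2)
      (?I e r)" if "?I e 0 \<sigma>'" for e \<sigma>'
  proof (rule reach_For[where Inv = "?I e"])
    fix l \<sigma>' assume l: "l < r" "?I e l \<sigma>'" "num \<sigma>' ''l'' = l"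
    have R: "block_upto (?L e (Suc l)) =
        (block_upto (?L e l))(?L e l := \<lambda>y. if y < block_cols then hash_entry l y else 0)"
      using \<open>l < r\<close> by (auto simp: block_upto_def fun_eq_iff less_Suc_eq)
    \<comment> \<open>Unwritten rows of \<open>block_upto\<close> vanish, so the next row already
      holds the empty sum.\<close>
    have I0: "block_upto (?L e l) =
        (block_upto (?L e l))(?L e l := \<lambda>y. if y < block_cols then ?acc l 0 y else 0)"
      by (auto simp: block_upto_def fun_eq_iff)
    have acc: "hash_entry l y = ?acc l top_rows y +
        (if y = n + n' then h (l * (top_rows + 1) + top_rows) else 0)" for y
      by (simp add: hash_entry_def)
    have new: "(block_upto (?L e l))(?L e l :=
          (\<lambda>y. if y < block_cols then ?acc l top_rows y else 0)
            (n + n' := ?acc l top_rows (n + n') + h (l * (top_rows + 1) + top_rows))) =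
        block_upto (?L e (Suc l))"
      unfolding R by (auto simp: fun_eq_iff acc)
    show "reach (?PI @
           [Store ''B'' (NVar ''R'') (NAdd (NVar ''n'') (NVar ''n1''))
              (FAdd (Entry ''B'' (NVar ''R'') (NAdd (NVar ''n'') (NVar ''n1'')))
                 (Entry ''H'' (NVar ''z'') (NConst 0)))] @
           [Assign ''z'' (NAdd (NVar ''z'') (NConst 1)),
            Assign ''R'' (NAdd (NVar ''R'') (NConst 1))]) \<sigma>'
        (top_rows * ((block_cols * (1 + 2) + 2 + 1) + 2) + 2 + (1 + 2))
        (\<lambda>\<sigma>'. ?I e (Suc l) \<sigma>' \<and> num \<sigma>' ''l'' = l)"
    proof (rule reach_append[OF I[where e = e and l = l]], goal_cases)
      case 1
      then show ?case
        using l I0 by auto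
    next
      case (2 \<sigma>1)
      then show ?case
      proof (intro reach_append[where I = "\<lambda>\<sigma>'. ?F \<sigma>' \<and> num \<sigma>' ''e'' = e \<and> num \<sigma>' ''l'' = l \<and>
            num \<sigma>' ''R'' = ?L e l \<and> num \<sigma>' ''z'' = l * (top_rows + 1) + top_rows \<and>
            arr \<sigma>' ''B'' = block_upto (?L e (Suc l))"] reach_Store1, goal_cases)
        case 1
        then show ?case
          by (simp only: new[symmetric]) simp
      next
        case (2 \<sigma>2)
        then show ?case
          by (intro reach_Assign2) auto
      qed
    qed
  qed (use that in auto)
  have E: "reach (For ''e'' (NVar ''d'') ([Assign ''z'' (NConst 0)] @ ?PL)) \<sigma>'
      (d * (1 + (r * ((top_rows * ((block_cols * (1 + 2) + 2 + 1) + 2) + 2 + (1 + 2)) + 2) + 2) + 2) + 2)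
      (?E d)" if "?E 0 \<sigma>'" for \<sigma>'
  proof (rule reach_For[where Inv = ?E])
    fix e \<sigma>' assume "e < d" "?E e \<sigma>'" "num \<sigma>' ''e'' = e"
    then have "reach ([Assign ''z'' (NConst 0)] @ ?PL) \<sigma>'
      (1 + (r * ((top_rows * ((block_cols * (1 + 2) + 2 + 1) + 2) + 2 + (1 + 2)) + 2) + 2)) (?I e r)"
      by (intro reach_append[where I = "?I e 0"] reach_Assign1 L) auto
    \<comment> \<open>After \<open>r\<close> checks the row count \<open>?L e r\<close> is the
      starting count \<open>?L (Suc e) 0\<close> of the next copy.\<close>
    then show "reach ([Assign ''z'' (NConst 0)] @ ?PL) \<sigma>'
      (1 + (r * ((top_rows * ((block_cols * (1 + 2) + 2 + 1) + 2) + 2 + (1 + 2)) + 2) + 2))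
      (\<lambda>\<sigma>'. ?E (Suc e) \<sigma>' \<and> num \<sigma>' ''e'' = e)"
      by (rule reach_mono) (auto simp: add.commute add.left_commute)
  qed (use that in auto)
  have "reach hash_prog \<sigma> (1 +
      (d * (1 + (r * ((top_rows * ((block_cols * (1 + 2) + 2 + 1) + 2) + 2 + (1 + 2)) + 2) + 2) + 2) + 2))
      (?E d)"
    unfolding hash_prog_def using assms
    by (intro reach_append[where I = "?E 0"] reach_Assign1 E) auto
  then show ?thesis
    by (rule reach_mono) (auto simp: algebra_simps)
qed

end

section \<open>The direct sum of the punctured copies\<close>

definition copy_prog :: "'a program" where
  "copy_prog =
     [Assign ''u'' (NConst 0), Assign ''w'' (NConst 0)] @
     For ''c'' (NVar ''m'')
       (For ''i'' (NVar ''R'')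
          [Cond (BAnd (BNot (Less (NVar ''i'') (NVar ''c''))) (BNot (Less (NVar ''c'') (NVar ''i''))))
             []
             (For ''j'' (NAdd (NAdd (NVar ''n'') (NVar ''n1'')) (NConst 1))
                [Store ''out'' (NAdd (NVar ''u'') (NVar ''i'')) (NAdd (NVar ''w'') (NVar ''j''))
                   (Entry ''B'' (NVar ''i'') (NVar ''j''))])] @
        [Assign ''u'' (NAdd (NVar ''u'') (NVar ''R'')),
         Assign ''w'' (NAdd (NVar ''w'') (NAdd (NAdd (NVar ''n'') (NVar ''n1'')) (NConst 1)))])"

definition output_prog :: "real \<Rightarrow> 'a program" where
  "output_prog \<alpha> =
     [Assign ''rows'' (NVar ''u''), Assign ''cols'' (NVar ''w'')] @
     [Assign ''k_out'' (NSub (NAdd (Floor \<alpha> (NVar ''d'')) (NVar ''k'')) (NConst 1))]"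

definition matrix_prog :: "real \<Rightarrow> 'a program" where
  "matrix_prog \<alpha> =
     fill_rows ''m'' ''n'' ''G'' ''t'' (NConst 0) (NConst 0) @
     fill_rows ''m1'' ''n1'' ''A'' ''s'' (NVar ''m'') (NVar ''n'') @
     hash_prog @ copy_prog @ output_prog \<alpha>"

definition reduction_prog :: "real \<Rightarrow> real \<Rightarrow> nat \<Rightarrow> 'a program" where
  "reduction_prog \<gamma> \<alpha> q = params_prog \<gamma> q @ draw_loop @ matrix_prog \<alpha>"

lemma scalars_reduction_prog: "scalars_of (reduction_prog \<gamma> \<alpha> q :: 'a program) \<subseteq> {\<gamma>, \<alpha>}"
  using scalars_nmul[of q "NVar ''X''"] scalars_nmul[of q "NVar ''p''"]
  by (auto simp: scalars_of_def reduction_prog_def params_prog_def draw_loop_def matrix_prog_def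
      fill_rows_def hash_prog_def copy_prog_def output_prog_def For_def)

lemma eq_mult_add_iff: "i < (R :: nat) \<Longrightarrow> x = c * R + i \<longleftrightarrow> x div R = c \<and> x mod R = i"
  by auto

context reduction
begin

abbreviation block :: "nat \<Rightarrow> nat \<Rightarrow> 'a" where "block \<equiv> block_upto block_rows"

text \<open>Position \<open>(x, y)\<close> lies in block row \<open>x div block_rows\<close> and
  block column \<open>y div block_cols\<close>. Only diagonal blocks are nonzero, and copy
  \<open>c\<close> has its row \<open>c\<close> replaced by 0. The triple \<open>(c, i, j)\<close>
  records lexicographically how far the nested loops of \<open>copy_prog\<close> have come.\<close>

definition out_upto :: "nat \<Rightarrow> nat \<Rightarrow> nat \<Rightarrow> nat \<Rightarrow> nat \<Rightarrow> 'a" where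
  "out_upto c i j x y =
     (if (x div block_rows < c \<or> x div block_rows = c \<and>
            (x mod block_rows < i \<or> x mod block_rows = i \<and> y mod block_cols < j)) \<and>
         y div block_cols = x div block_rows \<and> x mod block_rows \<noteq> x div block_rows
      then block (x mod block_rows) (y mod block_cols) else 0)"

lemma out_upto_store:
  assumes "i < block_rows" and "j < block_cols" and "i \<noteq> c"
  shows "(out_upto c i j)(c * block_rows + i :=
    (out_upto c i j (c * block_rows + i))(c * block_cols + j := block i j)) = out_upto c i (Suc j)"
proof (intro ext)
  fix x y
  \<comment> \<open>for plain variables, since the simplifier diverges on the quotients and remainders\<close>
  have generic: "(if (x1 = c \<and> x2 = i) \<and> (y1 = c \<and> y2 = j) then block i j
      else if (x1 < c \<or> x1 = c \<and> (x2 < i \<or> x2 = i \<and> y2 < j)) \<and> y1 = x1 \<and> x2 \<noteq> x1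
        then block x2 y2 else 0) =
    (if (x1 < c \<or> x1 = c \<and> (x2 < i \<or> x2 = i \<and> y2 < Suc j)) \<and> y1 = x1 \<and> x2 \<noteq> x1
      then block x2 y2 else 0)" for x1 x2 y1 y2
    using \<open>i \<noteq> c\<close> by (auto simp: less_Suc_eq)
  have "((out_upto c i j)(c * block_rows + i :=
      (out_upto c i j (c * block_rows + i))(c * block_cols + j := block i j))) x y =
    (if x = c * block_rows + i \<and> y = c * block_cols + j then block i j else out_upto c i j x y)"
    by (simp only: fun_upd_apply split: if_split) blast
  also have "\<dots> = out_upto c i (Suc j) x y"
    by (simp only: eq_mult_add_iff[OF assms(1)] eq_mult_add_iff[OF assms(2)] out_upto_def generic)
  finally show "((out_upto c i j)(c * block_rows + i :=
      (out_upto c i j (c * block_rows + i))(c * block_cols + j := block i j))) x y =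
    out_upto c i (Suc j) x y" .
qed

lemma out_upto_row: "out_upto c i block_cols = out_upto c (Suc i) 0"
proof -
  have "y mod block_cols < block_cols" for y
    by simp
  then show ?thesis
    by (intro ext) (simp only: out_upto_def less_Suc_eq not_less0 simp_thms)
qed

text \<open>The erased row of copy \<open>c\<close> stays 0, so passing over it already establishes
  the invariant of the next row.\<close>

lemma out_upto_skip: "out_upto c c 0 = out_upto c (Suc c) 0"
  by (auto simp: out_upto_def fun_eq_iff less_Suc_eq)

lemma out_upto_block:
  assumes "0 < block_rows"
  shows "out_upto c block_rows 0 = out_upto (Suc c) 0 0"
proof -
  have "x mod block_rows < block_rows" for x
    using assms by simp
  then show ?thesis
    by (intro ext) (simp only: out_upto_def less_Suc_eq not_less0 simp_thms)
qed

lemma reach_copy_prog: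
  assumes "ctx \<sigma>" and "arr \<sigma> ''B'' = block" and "num \<sigma> ''R'' = block_rows"
    and "arr \<sigma> ''out'' = (\<lambda>_ _. 0)" and "0 < m"
  shows "reach copy_prog \<sigma> (m * (block_rows * (3 * block_cols + 5) + 6) + 4)
    (\<lambda>\<sigma>'. ctx \<sigma>' \<and> arr \<sigma>' ''out'' = out_upto m 0 0 \<and>
       num \<sigma>' ''u'' = m * block_rows \<and> num \<sigma>' ''w'' = m * block_cols)"
proof -
  let ?F = "\<lambda>\<sigma>'. ctx \<sigma>' \<and> arr \<sigma>' ''B'' = block \<and> num \<sigma>' ''R'' = block_rows"
  let ?C = "\<lambda>c \<sigma>'. ?F \<sigma>' \<and> num \<sigma>' ''u'' = c * block_rows \<and> num \<sigma>' ''w'' = c * block_cols \<and>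
    arr \<sigma>' ''out'' = out_upto c 0 0"
  let ?I = "\<lambda>c i \<sigma>'. ?F \<sigma>' \<and> num \<sigma>' ''u'' = c * block_rows \<and> num \<sigma>' ''w'' = c * block_cols \<and>
    num \<sigma>' ''c'' = c \<and> arr \<sigma>' ''out'' = out_upto c i 0"
  let ?J = "\<lambda>c i j \<sigma>'. ?F \<sigma>' \<and> num \<sigma>' ''u'' = c * block_rows \<and> num \<sigma>' ''w'' = c * block_cols \<and>
    num \<sigma>' ''c'' = c \<and> num \<sigma>' ''i'' = i \<and> arr \<sigma>' ''out'' = out_upto c i j"
  let ?PJ = "For ''j'' (NAdd (NAdd (NVar ''n'') (NVar ''n1'')) (NConst 1))
                [Store ''out'' (NAdd (NVar ''u'') (NVar ''i'')) (NAdd (NVar ''w'') (NVar ''j''))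
                   (Entry ''B'' (NVar ''i'') (NVar ''j''))] :: 'a program"
  let ?b = "BAnd (BNot (Less (NVar ''i'') (NVar ''c''))) (BNot (Less (NVar ''c'') (NVar ''i'')))
    :: ('a, real) bexp"
  have J: "reach ?PJ \<sigma>' (block_cols * (1 + 2) + 2) (?J c i block_cols)"
    if "?J c i 0 \<sigma>'" "i < block_rows" "i \<noteq> c" for c i \<sigma>'
    using that
    by (intro reach_For[where Inv = "?J c i"] reach_Store1)
       (auto simp: out_upto_store[simplified])
  have I: "reach (For ''i'' (NVar ''R'') [Cond ?b [] ?PJ]) \<sigma>'
      (block_rows * (Suc (block_cols * (1 + 2) + 2) + 2) + 2) (?I c block_rows)"
    if "?I c 0 \<sigma>'" for c \<sigma>'
  proof (rule reach_For[where Inv = "?I c"])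
    fix i \<sigma>' assume i: "i < block_rows" "?I c i \<sigma>'" "num \<sigma>' ''i'' = i"
    show "reach [Cond ?b [] ?PJ] \<sigma>' (Suc (block_cols * (1 + 2) + 2))
      (\<lambda>\<sigma>'. ?I c (Suc i) \<sigma>' \<and> num \<sigma>' ''i'' = i)"
    proof (rule reach_Cond, cases "i = c")
      case True
      then show "reach ((if bval ?b \<sigma>' then [] else ?PJ) @ []) \<sigma>' (block_cols * (1 + 2) + 2)
          (\<lambda>\<sigma>'. ?I c (Suc i) \<sigma>' \<and> num \<sigma>' ''i'' = i)"
        using i by (auto intro!: reach_Nil simp: out_upto_skip)
    next
      case False
      then have "reach ?PJ \<sigma>' (block_cols * (1 + 2) + 2) (?J c i block_cols)"
        using i by (intro J) auto
      then have "reach ?PJ \<sigma>' (block_cols * (1 + 2) + 2)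
          (\<lambda>\<sigma>'. ?I c (Suc i) \<sigma>' \<and> num \<sigma>' ''i'' = i)"
        by (rule reach_mono) (auto simp only: out_upto_row)
      moreover have "\<not> bval ?b \<sigma>'"
        using i False by auto
      ultimately show "reach ((if bval ?b \<sigma>' then [] else ?PJ) @ []) \<sigma>' (block_cols * (1 + 2) + 2)
          (\<lambda>\<sigma>'. ?I c (Suc i) \<sigma>' \<and> num \<sigma>' ''i'' = i)"
        by (simp only: if_False append_Nil2)
    qed
  qed (use that in auto)
  have "reach copy_prog \<sigma>
      (2 + (m * ((block_rows * (Suc (block_cols * (1 + 2) + 2) + 2) + 2 + 2) + 2) + 2)) (?C m)"
    unfolding copy_prog_def
  proof (rule reach_append[where I = "?C 0"])
    show "reach [Assign ''u'' (NConst 0), Assign ''w'' (NConst 0)] \<sigma> 2 (?C 0)"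
      using assms by (intro reach_Assign2) (auto simp: out_upto_def fun_eq_iff)
  next
    fix \<sigma>1 assume "?C 0 \<sigma>1"
    then show "reach (For ''c'' (NVar ''m'')
       (For ''i'' (NVar ''R'') [Cond ?b [] ?PJ] @
        [Assign ''u'' (NAdd (NVar ''u'') (NVar ''R'')),
         Assign ''w'' (NAdd (NVar ''w'') (NAdd (NAdd (NVar ''n'') (NVar ''n1'')) (NConst 1)))])) \<sigma>1
       (m * ((block_rows * (Suc (block_cols * (1 + 2) + 2) + 2) + 2 + 2) + 2) + 2) (?C m)"
    proof (intro reach_For[where Inv = ?C])
      fix c \<sigma>2 assume "?C c \<sigma>2" "num \<sigma>2 ''c'' = c"
      then show "reach (For ''i'' (NVar ''R'') [Cond ?b [] ?PJ] @
          [Assign ''u'' (NAdd (NVar ''u'') (NVar ''R'')),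
           Assign ''w'' (NAdd (NVar ''w'') (NAdd (NAdd (NVar ''n'') (NVar ''n1'')) (NConst 1)))]) \<sigma>2
          (block_rows * (Suc (block_cols * (1 + 2) + 2) + 2) + 2 + 2)
          (\<lambda>\<sigma>'. ?C (Suc c) \<sigma>' \<and> num \<sigma>' ''c'' = c)"
        using \<open>0 < m\<close> by (intro reach_append[where I = "?I c block_rows"] I reach_Assign2)
          (auto simp: out_upto_block)
    qed auto
  qed
  then show ?thesis
    by (rule reach_mono) (auto simp: algebra_simps)
qed

definition matrix_time :: nat where
  "matrix_time = m * (3 * n + 5) + m' * (3 * n' + 5) +
     d * (r * (top_rows * (3 * block_cols + 5) + 7) + 5) +
     m * (block_rows * (3 * block_cols + 5) + 6) + 14"

lemma reach_matrix_prog: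
  assumes "ctx \<sigma>" and "arr \<sigma> ''B'' = (\<lambda>_ _. 0)" and "arr \<sigma> ''out'' = (\<lambda>_ _. 0)" and "0 < m"
  shows "reach (matrix_prog \<alpha>) \<sigma> matrix_time
    (\<lambda>\<sigma>'. arr \<sigma>' ''out'' = out_upto m 0 0 \<and> num \<sigma>' ''rows'' = m * block_rows \<and>
       num \<sigma>' ''cols'' = m * block_cols \<and> num \<sigma>' ''k_out'' = nat \<lfloor>\<alpha> * real d\<rfloor> + k - 1)"
proof -
  let ?O = "\<lambda>\<sigma>'. ctx \<sigma>' \<and> arr \<sigma>' ''out'' = (\<lambda>_ _. 0)"
  let ?B1 = "\<lambda>i j. if i < m then if j = n + n' then t i 0 else if j < n then g i j else 0 else 0"
  have fill1: "reach (fill_rows ''m'' ''n'' ''G'' ''t'' (NConst 0) (NConst 0)) \<sigma>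
      (m * (3 * n + 5) + 2) (\<lambda>\<sigma>'. ?O \<sigma>' \<and> arr \<sigma>' ''B'' = ?B1)"
    by (rule reach_mono[OF reach_fill_rows[where Y = n and X = m and b = g and w = t]])
       (use assms in \<open>auto simp: fun_eq_iff\<close>)
  have fill2: "reach (fill_rows ''m1'' ''n1'' ''A'' ''s'' (NVar ''m'') (NVar ''n'')) \<sigma>1
      (m' * (3 * n' + 5) + 2) (\<lambda>\<sigma>'. ?O \<sigma>' \<and> arr \<sigma>' ''B'' = block_upto top_rows)"
    if "?O \<sigma>1 \<and> arr \<sigma>1 ''B'' = ?B1" for \<sigma>1
    by (rule reach_mono[OF reach_fill_rows[where Y = n' and X = m' and b = a and w = s
            and ?row0.0 = m and ?col0.0 = n and ?b0.0 = ?B1]])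
       (use that in \<open>auto simp: block_upto_def top_entry_def fun_eq_iff\<close>)
  have out: "reach (output_prog \<alpha>) \<sigma>1 (2 + 1)
      (\<lambda>\<sigma>'. arr \<sigma>' ''out'' = out_upto m 0 0 \<and> num \<sigma>' ''rows'' = m * block_rows \<and>
       num \<sigma>' ''cols'' = m * block_cols \<and> num \<sigma>' ''k_out'' = nat \<lfloor>\<alpha> * real d\<rfloor> + k - 1)"
    if "ctx \<sigma>1 \<and> arr \<sigma>1 ''out'' = out_upto m 0 0 \<and>
       num \<sigma>1 ''u'' = m * block_rows \<and> num \<sigma>1 ''w'' = m * block_cols" for \<sigma>1
    unfolding output_prog_def using that
    by (intro reach_append[where I = "\<lambda>\<sigma>'. ctx \<sigma>' \<and> arr \<sigma>' ''out'' = out_upto m 0 0 \<and>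
          num \<sigma>' ''rows'' = m * block_rows \<and> num \<sigma>' ''cols'' = m * block_cols"]
        reach_Assign2 reach_Assign1) auto
  note parts = reach_append[OF fill1 reach_append[OF fill2 reach_append[OF reach_hash_prog
        reach_append[OF reach_copy_prog out]]]]
  show ?thesis
    unfolding matrix_prog_def
    by (rule reach_mono[OF parts]) (use \<open>0 < m\<close> in \<open>auto simp: matrix_time_def\<close>)
qed

end

section \<open>Weights of the output code\<close>

lemma sum_lessThan_add: "(\<Sum>j<n + n'. f j) = (\<Sum>j<n. f j) + (\<Sum>j<n'. f (n + j :: nat))"
  for f :: "nat \<Rightarrow> 'b :: comm_monoid_add"
  by (induction n') (simp_all add: add.assoc)

lemma sum_lessThan_mult: "(\<Sum>y<N * M. f y) = (\<Sum>c<N. \<Sum>j<M. f (c * M + j :: nat))"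
  for f :: "nat \<Rightarrow> 'b :: comm_monoid_add"
  by (induction N) (simp_all add: add.commute[of M] sum_lessThan_add)

lemma div_mod_mult_add:
  "j < (N :: nat) \<Longrightarrow> (c * N + j) div N = c" "j < N \<Longrightarrow> (c * N + j) mod N = j"
  by auto

lemma min_distance_le: "c \<in> C \<Longrightarrow> c \<noteq> 0\<^sub>v (dim_vec c) \<Longrightarrow> min_distance C \<le> hamming_weight c"
  unfolding min_distance_def by (rule INF_lower) auto

lemma hamming_weight_eq_0_iff: "hamming_weight v = 0 \<longleftrightarrow> v = 0\<^sub>v (dim_vec v)"
  by (auto simp: hamming_weight_def vec_eq_iff)

lemma hamming_weight_uminus [simp]: "hamming_weight (- v) = hamming_weight v"
  for v :: "'a :: field Matrix.vec"
  unfolding hamming_weight_def by (rule arg_cong[where f = card]) auto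

lemma hamming_weight_smult: "c \<noteq> 0 \<Longrightarrow> hamming_weight (c \<cdot>\<^sub>v v) = hamming_weight v"
  for v :: "'a :: field Matrix.vec"
  unfolding hamming_weight_def by (rule arg_cong[where f = card]) auto

lemma code_closed:
  assumes "G \<in> carrier_mat m n"
  shows "code G \<subseteq> carrier_vec m"
  using assms by (auto simp: code_def)

lemma finite_carrier_vec_finite: "finite (carrier_vec n :: 'a :: finite Matrix.vec set)"
proof (rule finite_subset)
  show "(carrier_vec n :: 'a Matrix.vec set) \<subseteq> Matrix.vec n ` ({..<n} \<rightarrow>\<^sub>E UNIV)"
  proof
    fix v :: "'a Matrix.vec" assume "v \<in> carrier_vec n"
    then have v: "v = Matrix.vec n (restrict (vec_index v) {..<n})"
      by (intro eq_vecI) auto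
    show "v \<in> Matrix.vec n ` ({..<n} \<rightarrow>\<^sub>E UNIV)"
      by (rule image_eqI, rule v, simp)
  qed
qed (intro finite_imageI finite_PiE, auto)

lemma finite_code: "G \<in> carrier_mat m n \<Longrightarrow> finite (code (G :: 'a :: {field, finite} mat))"
  by (rule finite_subset[OF code_closed finite_carrier_vec_finite])

section \<open>Codewords of the direct sum\<close>

context reduction
begin

text \<open>The coefficients are a function on the naturals instead of a vector, so that segments of
  a longer coefficient vector can be inserted without dimension conditions.\<close>

definition block_word :: "(nat \<Rightarrow> 'a) \<Rightarrow> nat \<Rightarrow> 'a" where
  "block_word \<zeta> i = (\<Sum>j<block_cols. block i j * \<zeta> j)"

definition punctured_weight :: "nat \<Rightarrow> (nat \<Rightarrow> 'a) \<Rightarrow> nat" where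
  "punctured_weight c \<zeta> = card {i. i < block_rows \<and> i \<noteq> c \<and> block_word \<zeta> i \<noteq> 0}"

definition out_mat :: "'a mat" where
  "out_mat = Matrix.mat (m * block_rows) (m * block_cols) (\<lambda>(i, j). out_upto m 0 0 i j)"

text \<open>The matrix is block diagonal: segment \<open>c\<close> of the product depends only on
  segment \<open>c\<close> of \<open>z\<close> and is a word of the block with coordinate
  \<open>c\<close> erased.\<close>

lemma out_mat_mult:
  assumes "z \<in> carrier_vec (m * block_cols)" and "x < m * block_rows"
  shows "vec_index (out_mat *\<^sub>v z) x = (if x mod block_rows = x div block_rows then 0
    else block_word (\<lambda>j. vec_index z (x div block_rows * block_cols + j)) (x mod block_rows))"
proof -
  let ?c = "x div block_rows"
  have "0 < block_rows"
    using assms(2) by (cases "block_rows = 0") auto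
  then have c: "?c < m"
    using assms(2) by (simp add: less_mult_imp_div_less)
  have entry: "out_upto m 0 0 x (c * block_cols + j) =
      (if c = ?c \<and> x mod block_rows \<noteq> ?c then block (x mod block_rows) j else 0)"
    if "j < block_cols" for c j
  proof -
    have "(c * block_cols + j) div block_cols = c" "(c * block_cols + j) mod block_cols = j"
      using that by (rule div_mod_mult_add)+
    then show ?thesis
      using c by (simp only: out_upto_def) auto
  qed
  have "vec_index (out_mat *\<^sub>v z) x =
      (\<Sum>y<m * block_cols. out_upto m 0 0 x y * vec_index z y)"
    using assms by (simp add: out_mat_def scalar_prod_def lessThan_atLeast0)
  also have "\<dots> = (\<Sum>c<m. \<Sum>j<block_cols.
      out_upto m 0 0 x (c * block_cols + j) * vec_index z (c * block_cols + j))"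
    by (rule sum_lessThan_mult)
  also have "\<dots> = (\<Sum>c<m. \<Sum>j<block_cols.
      (if c = ?c \<and> x mod block_rows \<noteq> ?c then block (x mod block_rows) j else 0) *
      vec_index z (c * block_cols + j))"
    by (intro sum.cong refl arg_cong2[where f = "(*)"] entry) simp
  also have "\<dots> = (\<Sum>c<m. if c = ?c then if x mod block_rows = ?c then 0
      else block_word (\<lambda>j. vec_index z (?c * block_cols + j)) (x mod block_rows) else 0)"
    by (intro sum.cong refl) (auto simp: block_word_def)
  also have "\<dots> = (if x mod block_rows = ?c then 0
      else block_word (\<lambda>j. vec_index z (?c * block_cols + j)) (x mod block_rows))"
    using c by simp
  finally show ?thesis .
qed

text \<open>The support of one summand embeds into that of the whole word by a shift. Together with
  \<open>out_mat_nonzero_block\<close> this reduces lower bounds to a single nonzero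
  summand.\<close>

lemma hamming_weight_out_ge:
  assumes "z \<in> carrier_vec (m * block_cols)" and "c < m"
  shows "punctured_weight c (\<lambda>j. vec_index z (c * block_cols + j)) \<le> hamming_weight (out_mat *\<^sub>v z)"
  unfolding punctured_weight_def hamming_weight_def
proof (rule card_inj_on_le[where f = "\<lambda>i. c * block_rows + i"])
  show "(\<lambda>i. c * block_rows + i) ` {i. i < block_rows \<and> i \<noteq> c \<and>
      block_word (\<lambda>j. vec_index z (c * block_cols + j)) i \<noteq> 0} \<subseteq>
    {i. i < dim_vec (out_mat *\<^sub>v z) \<and> vec_index (out_mat *\<^sub>v z) i \<noteq> 0}"
  proof safe
    fix i assume i: "i < block_rows" "i \<noteq> c"
      "block_word (\<lambda>j. vec_index z (c * block_cols + j)) i \<noteq> 0"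
    have "c * block_rows + i < Suc c * block_rows"
      using i(1) by simp
    also have "\<dots> \<le> m * block_rows"
      using \<open>c < m\<close> by (intro mult_le_mono1) simp
    finally have x: "c * block_rows + i < m * block_rows" .
    then show "c * block_rows + i < dim_vec (out_mat *\<^sub>v z)"
      by (simp add: out_mat_def)
    have 1: "(c * block_rows + i) div block_rows = c" "(c * block_rows + i) mod block_rows = i"
      using i(1) by (rule div_mod_mult_add)+
    show "vec_index (out_mat *\<^sub>v z) (c * block_rows + i) = 0 \<Longrightarrow> False"
      using i(2,3) unfolding out_mat_mult[OF assms(1) x] 1 by auto
  qed
qed (auto simp: inj_on_def)

lemma out_mat_nonzero_block:
  assumes "z \<in> carrier_vec (m * block_cols)" and "out_mat *\<^sub>v z \<noteq> 0\<^sub>v (dim_vec (out_mat *\<^sub>v z))"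
  obtains c where "c < m" and "punctured_weight c (\<lambda>j. vec_index z (c * block_cols + j)) \<noteq> 0"
proof -
  obtain x where x: "x < m * block_rows" "vec_index (out_mat *\<^sub>v z) x \<noteq> 0"
    using assms(2) by (auto simp: vec_eq_iff out_mat_def)
  then have "0 < block_rows"
    by (cases "block_rows = 0") auto
  then have "x div block_rows < m" "x mod block_rows < block_rows"
    using x(1) by (simp_all add: less_mult_imp_div_less)
  moreover have "x mod block_rows \<noteq> x div block_rows" and
    "block_word (\<lambda>j. vec_index z (x div block_rows * block_cols + j)) (x mod block_rows) \<noteq> 0"
    using x(2) unfolding out_mat_mult[OF assms(1) x(1)] by (auto split: if_splits)
  ultimately have "x mod block_rows \<in> {i. i < block_rows \<and> i \<noteq> x div block_rows \<and>
      block_word (\<lambda>j. vec_index z (x div block_rows * block_cols + j)) i \<noteq> 0}"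
    by blast
  then have "punctured_weight (x div block_rows)
      (\<lambda>j. vec_index z (x div block_rows * block_cols + j)) \<noteq> 0"
    unfolding punctured_weight_def by (subst card_0_eq) auto
  with \<open>x div block_rows < m\<close> show ?thesis
    by (rule that)
qed

text \<open>Coefficients supported in segment \<open>c\<close> realise any word of summand
  \<open>c\<close> alone; the upper bound of the YES case uses this.\<close>

lemma single_block_codeword:
  assumes "c < m"
  obtains z where "z \<in> carrier_vec (m * block_cols)"
    and "hamming_weight (out_mat *\<^sub>v z) = punctured_weight c \<zeta>"
proof -
  define z where "z = Matrix.vec (m * block_cols)
    (\<lambda>y. if y div block_cols = c then \<zeta> (y mod block_cols) else 0)"
  have z: "z \<in> carrier_vec (m * block_cols)"
    by (simp add: z_def)
  have zc: "vec_index z (c' * block_cols + j) = (if c' = c then \<zeta> j else 0)"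
    if "c' < m" "j < block_cols" for c' j
  proof -
    have "c' * block_cols + j < Suc c' * block_cols"
      using that(2) by simp
    also have "\<dots> \<le> m * block_cols"
      using that(1) by (intro mult_le_mono1) simp
    finally have 1: "c' * block_cols + j < m * block_cols" .
    have 2: "(c' * block_cols + j) div block_cols = c'" "(c' * block_cols + j) mod block_cols = j"
      using that(2) by (rule div_mod_mult_add)+
    show ?thesis
      unfolding z_def index_vec[OF 1] 2 ..
  qed
  have "hamming_weight (out_mat *\<^sub>v z) \<le> punctured_weight c \<zeta>"
    unfolding punctured_weight_def hamming_weight_def
  proof (rule card_inj_on_le[where f = "\<lambda>x. x mod block_rows"])
    \<comment> \<open>Nonzero coordinates occur only in segment \<open>c\<close>, hence
      \<open>x mod block_rows\<close> determines \<open>x\<close>.\<close>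
    have x: "x div block_rows = c \<and> x mod block_rows < block_rows \<and> x mod block_rows \<noteq> c \<and>
        block_word \<zeta> (x mod block_rows) \<noteq> 0"
      if "x < dim_vec (out_mat *\<^sub>v z)" "vec_index (out_mat *\<^sub>v z) x \<noteq> 0" for x
    proof -
      have lt: "x < m * block_rows"
        using that(1) by (simp add: out_mat_def)
      then have "0 < block_rows"
        by (cases "block_rows = 0") auto
      then have c': "x div block_rows < m" "x mod block_rows < block_rows"
        using lt by (simp_all add: less_mult_imp_div_less)
      have "block_word (\<lambda>j. vec_index z (x div block_rows * block_cols + j)) (x mod block_rows) =
          (if x div block_rows = c then block_word \<zeta> (x mod block_rows) else 0)"
        unfolding block_word_def using zc[OF c'(1)] by auto
      then show ?thesis
        using that(2) c'(2) unfolding out_mat_mult[OF z lt] by (auto split: if_splits)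
    qed
    show "inj_on (\<lambda>x. x mod block_rows)
        {i. i < dim_vec (out_mat *\<^sub>v z) \<and> vec_index (out_mat *\<^sub>v z) i \<noteq> 0}"
    proof (rule inj_onI)
      fix x y
      assume "x \<in> {i. i < dim_vec (out_mat *\<^sub>v z) \<and> vec_index (out_mat *\<^sub>v z) i \<noteq> 0}"
        and "y \<in> {i. i < dim_vec (out_mat *\<^sub>v z) \<and> vec_index (out_mat *\<^sub>v z) i \<noteq> 0}"
        and "x mod block_rows = y mod block_rows"
      then show "x = y"
        using x[of x] x[of y] by (metis (mono_tags, lifting) div_mod_decomp mem_Collect_eq)
    qed
    show "(\<lambda>x. x mod block_rows) `
        {i. i < dim_vec (out_mat *\<^sub>v z) \<and> vec_index (out_mat *\<^sub>v z) i \<noteq> 0} \<subseteq>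
      {i. i < block_rows \<and> i \<noteq> c \<and> block_word \<zeta> i \<noteq> 0}"
      using x by fast
  qed auto
  moreover have "punctured_weight c (\<lambda>j. vec_index z (c * block_cols + j)) = punctured_weight c \<zeta>"
    unfolding punctured_weight_def block_word_def using zc[OF assms] by simp
  ultimately show ?thesis
    using that[OF z] hamming_weight_out_ge[OF z assms] by simp
qed

end

text \<open>The checks form a random linear map on words of length \<open>K\<close>, whose matrix is
  stored row after row in \<open>h\<close>.\<close>

definition hash_value :: "nat \<Rightarrow> (nat \<Rightarrow> 'a :: comm_semiring_0) \<Rightarrow> (nat \<Rightarrow> 'a) \<Rightarrow> nat \<Rightarrow> 'a" where
  "hash_value K h w l = (\<Sum>i<K. h (l * K + i) * w i)"

text \<open>All positions from \<open>m + m'\<close> on hold \<open>\<beta>\<close>; hashing with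
  \<open>K = m + m' + 1\<close> reads just the first of them.\<close>

definition joint_word :: "nat \<Rightarrow> nat \<Rightarrow> 'a Matrix.vec \<Rightarrow> 'a Matrix.vec \<Rightarrow> 'a \<Rightarrow> nat \<Rightarrow> 'a" where
  "joint_word m m' u v \<beta> i =
     (if i < m then vec_index u i else if i < m + m' then vec_index v (i - m) else \<beta>)"

text \<open>All light vectors are covered, not only words of the code of \<open>G\<close>, so the
  event is independent of \<open>G\<close> and its failure is bounded by counting a Hamming
  ball.\<close>

definition separating :: "nat \<Rightarrow> nat \<Rightarrow> nat \<Rightarrow> nat \<Rightarrow> (nat \<Rightarrow> 'a :: field) \<Rightarrow> bool" where
  "separating m m' d r h \<longleftrightarrow>
     (\<forall>u \<in> carrier_vec m. u \<noteq> 0\<^sub>v m \<longrightarrow> hamming_weight u \<le> d \<longrightarrow>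
       (\<exists>l<r. hash_value (m + m' + 1) h (joint_word m m' u (0\<^sub>v m') 0) l \<noteq> 0))"

section \<open>Weights in one summand\<close>

locale matrix_reduction = reduction m n k m' n' d r "mat_entries G" "vec_entries tv" "mat_entries A" "vec_entries sv" h
  for m n k m' n' d r :: nat and G :: "'a :: {field, finite} mat" and tv A sv h +
  assumes G: "G \<in> carrier_mat m n" and tv: "tv \<in> carrier_vec m"
    and A: "A \<in> carrier_mat m' n'" and sv: "sv \<in> carrier_vec m'"
begin

definition ncp_word :: "(nat \<Rightarrow> 'a) \<Rightarrow> 'a Matrix.vec" where
  "ncp_word \<zeta> = G *\<^sub>v Matrix.vec n \<zeta> + \<zeta> (n + n') \<cdot>\<^sub>v tv"

definition dense_word :: "(nat \<Rightarrow> 'a) \<Rightarrow> 'a Matrix.vec" where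
  "dense_word \<zeta> = A *\<^sub>v Matrix.vec n' (\<lambda>j. \<zeta> (n + j)) + \<zeta> (n + n') \<cdot>\<^sub>v sv"

abbreviation joint :: "'a Matrix.vec \<Rightarrow> 'a Matrix.vec \<Rightarrow> 'a \<Rightarrow> nat \<Rightarrow> 'a" where
  "joint \<equiv> joint_word m m'"

abbreviation hash :: "(nat \<Rightarrow> 'a) \<Rightarrow> nat \<Rightarrow> 'a" where
  "hash \<equiv> hash_value (top_rows + 1) h"

lemma words_carrier [simp]: "ncp_word \<zeta> \<in> carrier_vec m" "dense_word \<zeta> \<in> carrier_vec m'"
  using G tv A sv by (auto simp: ncp_word_def dense_word_def)

lemma dim_words [simp]: "dim_vec (ncp_word \<zeta>) = m" "dim_vec (dense_word \<zeta>) = m'"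
  using words_carrier[of \<zeta>] by (simp_all only: carrier_vecD)

lemma top_entry_sum:
  assumes "i < top_rows"
  shows "(\<Sum>j<block_cols. top_entry i j * \<zeta> j) =
    joint (ncp_word \<zeta>) (dense_word \<zeta>) (\<zeta> (n + n')) i"
proof (cases "i < m")
  case True
  then show ?thesis
    using G tv
    by (simp add: joint_word_def ncp_word_def top_entry_def sum_lessThan_add scalar_prod_def
        mat_entries_def vec_entries_def atLeast0LessThan)
next
  case False
  then have "i - m < m'"
    using assms by simp
  then show ?thesis
    using False assms A sv
    by (simp add: joint_word_def dense_word_def top_entry_def sum_lessThan_add scalar_prod_def
        mat_entries_def vec_entries_def atLeast0LessThan)
qed

lemma block_word_top: "i < top_rows \<Longrightarrow> block_word \<zeta> i = joint (ncp_word \<zeta>) (dense_word \<zeta>) (\<zeta> (n + n')) i"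
  unfolding top_entry_sum[symmetric] by (simp add: block_word_def block_upto_def)

text \<open>By linearity, combining rows and then applying the coefficients is the same as combining
  the entries of the word. The copy number \<open>e\<close> disappears because the check rows repeat
  with period \<open>r\<close>.\<close>

lemma block_word_hash:
  assumes "e < d" and "l < r"
  shows "block_word \<zeta> (top_rows + (e * r + l)) =
    hash (joint (ncp_word \<zeta>) (dense_word \<zeta>) (\<zeta> (n + n'))) l"
proof -
  let ?w = "joint (ncp_word \<zeta>) (dense_word \<zeta>) (\<zeta> (n + n'))"
  let ?K = "top_rows + 1"
  have "e * r + l < Suc e * r"
    using \<open>l < r\<close> by simp
  also have "\<dots> \<le> d * r"
    using \<open>e < d\<close> by (intro mult_le_mono1) simp
  finally have "block (top_rows + (e * r + l)) j = hash_entry l j" if "j < block_cols" for j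
    using that \<open>l < r\<close> by (simp add: block_upto_def)
  then have "block_word \<zeta> (top_rows + (e * r + l)) = (\<Sum>j<block_cols. hash_entry l j * \<zeta> j)"
    unfolding block_word_def by (intro sum.cong) auto
  also have "\<dots> = (\<Sum>j<block_cols. \<Sum>i<top_rows. h (l * ?K + i) * (top_entry i j * \<zeta> j)) +
      h (l * ?K + top_rows) * \<zeta> (n + n')"
    by (simp add: hash_entry_def ring_distribs sum.distrib sum_distrib_right mult.assoc)
  also have "(\<Sum>j<block_cols. \<Sum>i<top_rows. h (l * ?K + i) * (top_entry i j * \<zeta> j)) =
      (\<Sum>i<top_rows. h (l * ?K + i) * ?w i)"
    by (subst sum.swap, intro sum.cong refl)
       (simp only: sum_distrib_left[symmetric] top_entry_sum lessThan_iff)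
  also have "\<dots> + h (l * ?K + top_rows) * \<zeta> (n + n') = hash ?w l"
    by (simp add: hash_value_def joint_word_def)
  finally show ?thesis .
qed

lemma punctured_weight_ncp:
  assumes "c < m"
  shows "hamming_weight (ncp_word \<zeta>) \<le> punctured_weight c \<zeta> + 1"
proof -
  let ?U = "{i. i < dim_vec (ncp_word \<zeta>) \<and> vec_index (ncp_word \<zeta>) i \<noteq> 0}"
  have "?U - {c} \<subseteq> {i. i < block_rows \<and> i \<noteq> c \<and> block_word \<zeta> i \<noteq> 0}"
    by (auto simp: block_word_top joint_word_def)
  then have "card (?U - {c}) \<le> punctured_weight c \<zeta>"
    unfolding punctured_weight_def by (intro card_mono) auto
  moreover have "card ?U \<le> card (?U - {c}) + 1"
    using diff_card_le_card_Diff[of "{c}" ?U] by simp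
  ultimately show ?thesis
    by (simp add: hamming_weight_def)
qed

text \<open>The erased coordinate \<open>c < m\<close> lies in the first part, so the second part
  counts in full.\<close>

lemma punctured_weight_dense:
  assumes "c < m"
  shows "hamming_weight (dense_word \<zeta>) \<le> punctured_weight c \<zeta>"
  unfolding hamming_weight_def punctured_weight_def
proof (rule card_inj_on_le[where f = "\<lambda>i. m + i"])
  show "(\<lambda>i. m + i) ` {i. i < dim_vec (dense_word \<zeta>) \<and> vec_index (dense_word \<zeta>) i \<noteq> 0} \<subseteq>
    {i. i < block_rows \<and> i \<noteq> c \<and> block_word \<zeta> i \<noteq> 0}"
    using assms by (auto simp: block_word_top joint_word_def)
qed auto

text \<open>A violated check shows up in all of its \<open>d\<close> copies, none of which is erased
  because \<open>c < m\<close>.\<close>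

lemma punctured_weight_hash:
  assumes "c < m" and "l < r" and "hash (joint (ncp_word \<zeta>) (dense_word \<zeta>) (\<zeta> (n + n'))) l \<noteq> 0"
  shows "d \<le> punctured_weight c \<zeta>"
proof -
  have "card {..<d} \<le> punctured_weight c \<zeta>"
    unfolding punctured_weight_def
  proof (rule card_inj_on_le[where f = "\<lambda>e. top_rows + (e * r + l)"])
    show "inj_on (\<lambda>e. top_rows + (e * r + l)) {..<d}"
      using \<open>l < r\<close> by (auto simp: inj_on_def)
    show "(\<lambda>e. top_rows + (e * r + l)) ` {..<d} \<subseteq>
      {i. i < block_rows \<and> i \<noteq> c \<and> block_word \<zeta> i \<noteq> 0}"
    proof safe
      fix e assume "e < d"
      have "e * r + l < Suc e * r"
        using \<open>l < r\<close> by simp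
      also have "\<dots> \<le> d * r"
        using \<open>e < d\<close> by (intro mult_le_mono1) simp
      finally show "top_rows + (e * r + l) < block_rows"
        by simp
      show "block_word \<zeta> (top_rows + (e * r + l)) = 0 \<Longrightarrow> False"
        using assms(3) by (simp add: block_word_hash \<open>e < d\<close> \<open>l < r\<close>)
    qed (use \<open>c < m\<close> in auto)
  qed auto
  then show ?thesis
    by simp
qed

text \<open>When all checks vanish, only top rows contribute. The support of the first part is kept
  as a set without \<open>c\<close>, so that choosing \<open>c\<close> in the support saves
  one.\<close>

lemma punctured_weight_upper:
  assumes "\<And>l. l < r \<Longrightarrow> hash (joint (ncp_word \<zeta>) (dense_word \<zeta>) (\<zeta> (n + n'))) l = 0"
  shows "punctured_weight c \<zeta> \<le>
    card ({i. i < m \<and> vec_index (ncp_word \<zeta>) i \<noteq> 0} - {c}) + hamming_weight (dense_word \<zeta>)"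
proof -
  let ?U = "{i. i < m \<and> vec_index (ncp_word \<zeta>) i \<noteq> 0} - {c}"
  let ?V = "{i. i < m' \<and> vec_index (dense_word \<zeta>) i \<noteq> 0}"
  have "{i. i < block_rows \<and> i \<noteq> c \<and> block_word \<zeta> i \<noteq> 0} \<subseteq> ?U \<union> (+) m ` ?V"
  proof
    fix i assume i: "i \<in> {i. i < block_rows \<and> i \<noteq> c \<and> block_word \<zeta> i \<noteq> 0}"
    have "i < top_rows"
    proof (rule ccontr)
      assume "\<not> i < top_rows"
      define e l where "e = (i - top_rows) div r" and "l = (i - top_rows) mod r"
      have lt: "i - top_rows < d * r"
        using i \<open>\<not> i < top_rows\<close> by auto
      then have "0 < r"
        by (cases "r = 0") auto
      then have "e < d" "l < r"
        using lt by (simp_all add: e_def l_def less_mult_imp_div_less)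
      moreover have "i = top_rows + (e * r + l)"
        using \<open>\<not> i < top_rows\<close> by (simp add: e_def l_def)
      ultimately show False
        using i assms block_word_hash by auto
    qed
    then show "i \<in> ?U \<union> (+) m ` ?V"
      using i by (cases "i < m") (auto simp: block_word_top joint_word_def intro!: image_eqI[of _ _ "i - m"])
  qed
  then have "punctured_weight c \<zeta> \<le> card (?U \<union> (+) m ` ?V)"
    unfolding punctured_weight_def by (intro card_mono) auto
  also have "\<dots> \<le> card ?U + card ((+) m ` ?V)"
    by (rule card_Un_le)
  also have "card ((+) m ` ?V) = card ?V"
    by (intro card_image) auto
  finally show ?thesis
    by (simp add: hamming_weight_def)
qed

lemma code_dist_le: "x \<in> carrier_vec n \<Longrightarrow> code_dist tv (code G) \<le> hamming_weight (tv - G *\<^sub>v x)"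
proof -
  assume x: "x \<in> carrier_vec n"
  have "finite (code G)"
    using finite_code[OF G] .
  then show ?thesis
    using x G unfolding code_dist_def by (intro Min_le) (auto simp: code_def)
qed

text \<open>Where the weight comes from the first part it exceeds \<open>d\<close> strictly, which
  makes up for the erased coordinate; the second part and the checks lose nothing.\<close>

lemma punctured_weight_no:
  assumes "c < m" and dist: "d < code_dist tv (code G)" and minA: "ereal (real d) < min_distance (code A)"
    and sep: "separating m m' d r h" and nonzero: "punctured_weight c \<zeta> \<noteq> 0"
  shows "d \<le> punctured_weight c \<zeta>"
proof -
  let ?\<beta> = "\<zeta> (n + n')"
  let ?x = "Matrix.vec n \<zeta>" and ?y = "Matrix.vec n' (\<lambda>j. \<zeta> (n + j))"
  show ?thesis
  proof (cases "?\<beta> = 0")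
    case False
    \<comment> \<open>Dividing by \<open>?\<beta>\<close> turns the word into the difference of
      \<open>tv\<close> and a codeword without changing its weight.\<close>
    have "ncp_word \<zeta> = ?\<beta> \<cdot>\<^sub>v (tv - G *\<^sub>v ((- inverse ?\<beta>) \<cdot>\<^sub>v ?x))"
    proof -
      have "G *\<^sub>v ((- inverse ?\<beta>) \<cdot>\<^sub>v ?x) = (- inverse ?\<beta>) \<cdot>\<^sub>v (G *\<^sub>v ?x)"
        using G by (intro mult_mat_vec) auto
      then show ?thesis
        unfolding ncp_word_def using G tv False
        by (intro eq_vecI) (auto simp: algebra_simps)
    qed
    then have "hamming_weight (ncp_word \<zeta>) = hamming_weight (tv - G *\<^sub>v ((- inverse ?\<beta>) \<cdot>\<^sub>v ?x))"
      using False by (simp add: hamming_weight_smult)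
    moreover have "code_dist tv (code G) \<le> hamming_weight (tv - G *\<^sub>v ((- inverse ?\<beta>) \<cdot>\<^sub>v ?x))"
      by (intro code_dist_le) auto
    ultimately show ?thesis
      using punctured_weight_ncp[OF \<open>c < m\<close>, of \<zeta>] dist by linarith
  next
    case True
    then have u: "ncp_word \<zeta> = G *\<^sub>v ?x" and v: "dense_word \<zeta> = A *\<^sub>v ?y"
      using G tv A sv by (auto simp: ncp_word_def dense_word_def)
    show ?thesis
    proof (cases "dense_word \<zeta> = 0\<^sub>v m'")
      case False
      \<comment> \<open>As \<open>?\<beta> = 0\<close>, the second part is a nonzero codeword of
        \<open>A\<close>.\<close>
      then have "min_distance (code A) \<le> hamming_weight (dense_word \<zeta>)"
        using v A
        by (intro min_distance_le) (auto simp: code_def)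
      then have "ereal (real d) < ereal (real (hamming_weight (dense_word \<zeta>)))"
        using minA by (rule less_le_trans[rotated])
      then show ?thesis
        using punctured_weight_dense[OF \<open>c < m\<close>, of \<zeta>] by simp
    next
      case v0: True
      show ?thesis
      proof (cases "ncp_word \<zeta> = 0\<^sub>v m")
        case u0: True
        \<comment> \<open>Both parts and the coefficient vanish, hence so do all rows, contrary to
          \<open>nonzero\<close>.\<close>
        have "hash (joint (ncp_word \<zeta>) (dense_word \<zeta>) ?\<beta>) l = 0" for l
          unfolding hash_value_def by (rule sum.neutral) (auto simp: u0 v0 True joint_word_def)
        moreover have empty: "{i. i < m \<and> vec_index (ncp_word \<zeta>) i \<noteq> 0} - {c} = {}"
          unfolding u0 by auto
        moreover have "hamming_weight (dense_word \<zeta>) = 0"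
          unfolding hamming_weight_eq_0_iff dim_words by (rule v0)
        ultimately have "punctured_weight c \<zeta> \<le> 0"
          using punctured_weight_upper[of \<zeta> c] unfolding empty by simp
        then show ?thesis
          using nonzero by simp
      next
        case False
        show ?thesis
        proof (cases "hamming_weight (ncp_word \<zeta>) \<le> d")
          case le: True
          \<comment> \<open>The only dangerous words: nonzero and light in the first part, zero
            elsewhere. A violated check supplies the weight.\<close>
          then obtain l where "l < r" "hash (joint (ncp_word \<zeta>) (0\<^sub>v m') 0) l \<noteq> 0"
            using sep False unfolding separating_def by auto
          then show ?thesis
            using punctured_weight_hash[OF \<open>c < m\<close>, of l \<zeta>] v0 True by simp
        next
          case False
          then show ?thesis
            using punctured_weight_ncp[OF \<open>c < m\<close>, of \<zeta>] by simp
        qed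
      qed
    qed
  qed
qed

lemma min_distance_out_ge:
  assumes "d < code_dist tv (code G)" and "ereal (real d) < min_distance (code A)" and "separating m m' d r h"
  shows "ereal (real d) \<le> min_distance (code out_mat)"
  unfolding min_distance_def
proof (rule INF_greatest)
  fix w assume w: "w \<in> {c \<in> code out_mat. c \<noteq> 0\<^sub>v (dim_vec c)}"
  then obtain z where z: "z \<in> carrier_vec (m * block_cols)" "w = out_mat *\<^sub>v z"
    by (auto simp: code_def out_mat_def)
  then obtain c where c: "c < m" "punctured_weight c (\<lambda>j. vec_index z (c * block_cols + j)) \<noteq> 0"
    using w out_mat_nonzero_block by auto
  show "ereal (real d) \<le> ereal (real (hamming_weight w))"
    using punctured_weight_no[OF c(1) assms c(2)] hamming_weight_out_ge[OF z(1) c(1)] z(2) by simp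
qed

text \<open>A suitable summand erases a coordinate in the support of \<open>u\<close>, whence
  \<open>k - 1\<close>. The condition \<open>v \<noteq> 0\<^sub>v m'\<close> guarantees that the
  word remains nonzero after the erasure.\<close>

lemma min_distance_out_le:
  assumes "0 < m" and x: "x \<in> carrier_vec n" and y: "y \<in> carrier_vec n'"
    and u: "u = G *\<^sub>v x + tv" and v: "v = A *\<^sub>v y + sv" and "v \<noteq> 0\<^sub>v m'"
    and "hamming_weight u \<le> k" and "0 < k"
    and hash: "\<And>l. l < r \<Longrightarrow> hash (joint u v 1) l = 0"
  shows "min_distance (code out_mat) \<le> ereal (real (k - 1 + hamming_weight v))"
proof -
  define \<zeta> where "\<zeta> j = (if j < n then vec_index x j else if j < n + n' then vec_index y (j - n) else 1)"
    for j
  have words: "ncp_word \<zeta> = u" "dense_word \<zeta> = v" "\<zeta> (n + n') = 1"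
  proof -
    have "Matrix.vec n \<zeta> = x" "Matrix.vec n' (\<lambda>j. \<zeta> (n + j)) = y"
      using x y by (auto simp: \<zeta>_def)
    moreover show "\<zeta> (n + n') = 1"
      by (simp add: \<zeta>_def)
    ultimately show "ncp_word \<zeta> = u" "dense_word \<zeta> = v"
      by (simp_all add: ncp_word_def dense_word_def u v)
  qed
  have dims: "dim_vec u = m" "dim_vec v = m'"
    using dim_words[of \<zeta>] by (simp_all add: words)
  let ?U = "{i. i < m \<and> vec_index u i \<noteq> 0}"
  \<comment> \<open>If \<open>u\<close> is zero, nothing has to be saved and summand 0, which exists
    by \<open>0 < m\<close>, will do.\<close>
  obtain c where c: "c < m" "card (?U - {c}) \<le> k - 1"
  proof (cases "?U = {}")
    case True
    then have "?U - {0} = {}"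
      by blast
    then have "card (?U - {0}) \<le> k - 1"
      by (simp only: card.empty)
    with \<open>0 < m\<close> show ?thesis
      by (rule that)
  next
    case False
    then obtain c where "c \<in> ?U"
      by blast
    moreover from this have "card (?U - {c}) = card ?U - 1"
      by (rule card_Diff_singleton)
    ultimately show ?thesis
      using \<open>hamming_weight u \<le> k\<close> dims by (intro that[of c]) (auto simp: hamming_weight_def)
  qed
  obtain z where z: "z \<in> carrier_vec (m * block_cols)"
      "hamming_weight (out_mat *\<^sub>v z) = punctured_weight c \<zeta>"
    using single_block_codeword[OF c(1)] by blast
  have "punctured_weight c \<zeta> \<le> card (?U - {c}) + hamming_weight v"
    using punctured_weight_upper[of \<zeta> c] hash by (simp add: words)
  moreover have "0 < hamming_weight v"
    using hamming_weight_eq_0_iff[of v] \<open>v \<noteq> 0\<^sub>v m'\<close> dims by auto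
  moreover have "hamming_weight v \<le> punctured_weight c \<zeta>"
    using punctured_weight_dense[OF c(1), of \<zeta>] by (simp add: words)
  ultimately have "0 < hamming_weight (out_mat *\<^sub>v z)"
    and le: "hamming_weight (out_mat *\<^sub>v z) \<le> k - 1 + hamming_weight v"
    using c(2) z(2) by auto
  then have "min_distance (code out_mat) \<le> ereal (real (hamming_weight (out_mat *\<^sub>v z)))"
    using z(1) hamming_weight_eq_0_iff[of "out_mat *\<^sub>v z"]
    by (intro min_distance_le) (auto simp: code_def out_mat_def)
  also have "\<dots> \<le> ereal (real (k - 1 + hamming_weight v))"
    using le by simp
  finally show ?thesis .
qed

end

section \<open>Random linear hashing\<close>

text \<open>Given the coordinates outside \<open>J\<close>, exactly one of the
  \<open>CARD('a) ^ card J\<close> equally likely fillings of \<open>J\<close> lies in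
  \<open>E\<close>. This conditional probability is constant, hence equal to the total one.\<close>

lemma prob_unique_completion:
  fixes E :: "('i \<Rightarrow> 'a :: {zero, finite}) set"
  assumes "finite I" and "J \<subseteq> I"
    and unique: "\<And>g. \<exists>f0. \<forall>f. f \<in> PiE_dflt J 0 (\<lambda>_. UNIV) \<and>
      (\<lambda>x. if x \<in> J then f x else g x) \<in> E \<longleftrightarrow> f = f0"
  shows "measure_pmf.prob (uniform_fun I) E = 1 / real CARD('a) ^ card J"
proof -
  let ?c = "1 / real CARD('a) ^ card J"
  have fin: "finite J" "finite (I - J)"
    using assms finite_subset by auto
  have fiber: "measure_pmf.prob (uniform_fun J) {f. (\<lambda>x. if x \<in> J then f x else g x) \<in> E} = ?c" for g
  proof -
    obtain f0 where "\<forall>f. f \<in> PiE_dflt J 0 (\<lambda>_. UNIV) \<and>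
        (\<lambda>x. if x \<in> J then f x else g x) \<in> E \<longleftrightarrow> f = f0"
      using unique by blast
    then have "PiE_dflt J 0 (\<lambda>_. UNIV) \<inter> {f. (\<lambda>x. if x \<in> J then f x else g x) \<in> E} = {f0}"
      by blast
    moreover have "uniform_fun J = pmf_of_set (PiE_dflt J 0 (\<lambda>_. UNIV :: 'a set))"
      using fin by (intro Pi_pmf_of_set) auto
    ultimately show ?thesis
      using fin by (simp add: measure_pmf_of_set finite_PiE_dflt card_PiE_dflt)
  qed
  have "uniform_fun I = uniform_fun (J \<union> (I - J))"
    using assms(2) by (intro arg_cong[where f = uniform_fun]) auto
  \<comment> \<open>The coordinates outside \<open>J\<close> are drawn first, so that the
    probability can be computed conditionally on them.\<close>
  also have "\<dots> = bind_pmf (uniform_fun (I - J))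
      (\<lambda>g. map_pmf (\<lambda>f x. if x \<in> J then f x else g x) (uniform_fun J))"
    using fin by (subst Pi_pmf_union, simp, simp, blast)
      (simp add: pair_pmf_def map_pmf_def bind_assoc_pmf bind_return_pmf, rule bind_commute_pmf)
  finally have eq: "uniform_fun I = bind_pmf (uniform_fun (I - J))
      (\<lambda>g. map_pmf (\<lambda>f x. if x \<in> J then f x else g x) (uniform_fun J))" .
  have "emeasure (uniform_fun I) E = (\<integral>\<^sup>+ g. emeasure (map_pmf (\<lambda>f x. if x \<in> J then f x else g x)
      (uniform_fun J)) E \<partial>measure_pmf (uniform_fun (I - J)))"
    unfolding eq by (rule emeasure_bind_pmf)
  also have "\<dots> = (\<integral>\<^sup>+ g. ennreal ?c \<partial>measure_pmf (uniform_fun (I - J) :: ('i \<Rightarrow> 'a) pmf))"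
    using fiber by (simp add: measure_pmf.emeasure_eq_measure vimage_def)
  also have "\<dots> = ennreal ?c"
    by simp
  finally have "emeasure (uniform_fun I) E = ennreal ?c" .
  then show ?thesis
    by (simp add: measure_pmf.emeasure_eq_measure)
qed

text \<open>With pivots at the indices in \<open>S\<close> of every check, the vanishing of a check
  becomes a linear equation in the pivots \<open>f\<close> whose constant term comes from the other
  coefficients \<open>g\<close>.\<close>

lemma hash_value_split:
  fixes f g w :: "nat \<Rightarrow> 'a :: comm_semiring_0"
  assumes "S \<subseteq> {..<K}" and "l < r"
  shows "hash_value K (\<lambda>x. if x \<in> (\<lambda>(l, i). l * K + i) ` ({..<r} \<times> S) then f x else g x) w l =
    (\<Sum>i\<in>S. f (l * K + i) * w i) + (\<Sum>i\<in>{..<K} - S. g (l * K + i) * w i)"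
proof -
  have mem: "l * K + i \<in> (\<lambda>(l, i). l * K + i) ` ({..<r} \<times> S) \<longleftrightarrow> i \<in> S" if "i < K" for i
  proof
    assume "l * K + i \<in> (\<lambda>(l, i). l * K + i) ` ({..<r} \<times> S)"
    then obtain l' i' where "l * K + i = l' * K + i'" "i' \<in> S"
      by auto
    moreover from this have "i = i'"
      using assms(1) div_mod_mult_add(2)[OF that, of l] div_mod_mult_add(2)[of i' K l'] by auto
    ultimately show "i \<in> S"
      by simp
  qed (use \<open>l < r\<close> in force)
  show ?thesis
    unfolding hash_value_def sum.subset_diff[OF assms(1) finite_lessThan] add.commute[of "sum _ S"]
    using assms(1) by (intro arg_cong2[where f = "(+)"] sum.cong refl) (auto simp: mem subset_iff)
qed

lemma pivot_set:
  assumes "S \<subseteq> {..<K}"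
  shows "(\<lambda>(l, i). l * K + i) ` ({..<r} \<times> S) \<subseteq> {..<r * K}"
    and "card ((\<lambda>(l, i). l * K + i) ` ({..<r} \<times> S)) = r * card S"
proof -
  show "(\<lambda>(l, i). l * K + i) ` ({..<r} \<times> S) \<subseteq> {..<r * K}"
  proof safe
    fix l i assume "l < r" "i \<in> S"
    then have "l * K + i < Suc l * K"
      using assms by auto
    also have "\<dots> \<le> r * K"
      using \<open>l < r\<close> by (intro mult_le_mono1) simp
    finally show "l * K + i < r * K" .
  qed
  have "inj_on (\<lambda>(l, i). l * K + i) ({..<r} \<times> S)"
  proof (rule inj_onI, clarify)
    fix l i l' i' assume "i \<in> S" "i' \<in> S" and eq: "l * K + i = l' * K + i'"
    then have "i < K" "i' < K"
      using assms by auto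
    then show "l = l' \<and> i = i'"
      using eq div_mod_mult_add[of i K l] div_mod_mult_add[of i' K l'] by metis
  qed
  then show "card ((\<lambda>(l, i). l * K + i) ` ({..<r} \<times> S)) = r * card S"
    by (simp add: card_image card_cartesian_product)
qed

text \<open>The pivot of each check is its coefficient at \<open>i0\<close>: as
  \<open>w i0 \<noteq> 0\<close>, exactly one value of it makes the check vanish, whatever the other
  coefficients are.\<close>

lemma prob_hash_zero:
  fixes w :: "nat \<Rightarrow> 'a :: {field, finite}"
  assumes "i0 < K" and "w i0 \<noteq> 0"
  shows "measure_pmf.prob (uniform_fun {..<r * K}) {h. \<forall>l<r. hash_value K h w l = 0} =
    1 / real CARD('a) ^ r"
proof -
  define J where "J = (\<lambda>(l, i). l * K + i) ` ({..<r} \<times> {i0})"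
  have S: "{i0} \<subseteq> {..<K}"
    using assms by simp
  have "measure_pmf.prob (uniform_fun {..<r * K}) {h. \<forall>l<r. hash_value K h w l = 0} =
      1 / real CARD('a) ^ card J"
  proof (rule prob_unique_completion)
    show "J \<subseteq> {..<r * K}"
      unfolding J_def by (rule pivot_set(1)[OF S])
    fix g :: "nat \<Rightarrow> 'a"
    define \<rho> where "\<rho> l = (\<Sum>i\<in>{..<K} - {i0}. g (l * K + i) * w i)" for l
    define f0 where "f0 x = (if x \<in> J then - \<rho> (x div K) / w i0 else 0)" for x
    have pivot: "(x \<in> J) = (\<exists>l<r. x = l * K + i0)" for x
      by (auto simp: J_def)
    have hash: "hash_value K (\<lambda>x. if x \<in> J then f x else g x) w l = f (l * K + i0) * w i0 + \<rho> l"
      if "l < r" for f l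
      unfolding J_def hash_value_split[OF S that] \<rho>_def by simp
    have f0: "f0 (l * K + i0) = - \<rho> l / w i0" if "l < r" for l
      using that div_mod_mult_add(1)[OF \<open>i0 < K\<close>, of l] by (auto simp: f0_def pivot)
    show "\<exists>f0. \<forall>f. f \<in> PiE_dflt J 0 (\<lambda>_. UNIV) \<and>
      (\<lambda>x. if x \<in> J then f x else g x) \<in> {h. \<forall>l<r. hash_value K h w l = 0} \<longleftrightarrow> f = f0"
    proof (intro exI[of _ f0] allI iffI)
      fix f
      assume f: "f \<in> PiE_dflt J 0 (\<lambda>_. UNIV) \<and>
        (\<lambda>x. if x \<in> J then f x else g x) \<in> {h. \<forall>l<r. hash_value K h w l = 0}"
      show "f = f0"
      proof
        fix x
        show "f x = f0 x"
        proof (cases "x \<in> J")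
          case True
          then obtain l where l: "l < r" "x = l * K + i0"
            using pivot by blast
          then have "f x * w i0 + \<rho> l = 0"
            using f hash by auto
          then have "f x * w i0 = - \<rho> l"
            by (simp add: eq_neg_iff_add_eq_0)
          then have "f x = - \<rho> l / w i0"
            using assms(2) by (metis nonzero_mult_div_cancel_right)
          then show ?thesis
            using f0[OF l(1)] l(2) by simp
        next
          case False
          then show ?thesis
            using f by (auto simp: PiE_dflt_def f0_def)
        qed
      qed
    next
      fix f assume "f = f0"
      then show "f \<in> PiE_dflt J 0 (\<lambda>_. UNIV) \<and>
        (\<lambda>x. if x \<in> J then f x else g x) \<in> {h. \<forall>l<r. hash_value K h w l = 0}"
        using assms(2) by (auto simp: hash f0) (simp add: PiE_dflt_def f0_def)
    qed
  qed simp
  then show ?thesis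
    using pivot_set(2)[OF S, of r] by (simp add: J_def)
qed

text \<open>Each check has two pivots. At \<open>i1\<close> both words are 1 and at
  \<open>i0\<close> they differ, so the two equations have determinant \<open>w i0 - w' i0\<close>,
  which is nonzero, and exactly one solution. Hence the two events are independent.\<close>

lemma prob_hash_zero_pair:
  fixes w w' :: "nat \<Rightarrow> 'a :: {field, finite}"
  assumes "i0 < K" and "w i0 \<noteq> w' i0" and "i1 < K" and "w i1 = 1" and "w' i1 = 1"
  shows "measure_pmf.prob (uniform_fun {..<r * K})
      ({h. \<forall>l<r. hash_value K h w l = 0} \<inter> {h. \<forall>l<r. hash_value K h w' l = 0}) =
    1 / (real CARD('a) ^ r)\<^sup>2"
proof -
  have "i0 \<noteq> i1"
    using assms by auto
  define J where "J = (\<lambda>(l, i). l * K + i) ` ({..<r} \<times> {i0, i1})"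
  have S: "{i0, i1} \<subseteq> {..<K}"
    using assms by simp
  define E where "E = {h. \<forall>l<r. hash_value K h w l = 0} \<inter> {h. \<forall>l<r. hash_value K h w' l = 0}"
  have "measure_pmf.prob (uniform_fun {..<r * K}) E = 1 / real CARD('a) ^ card J"
  proof (rule prob_unique_completion)
    show "J \<subseteq> {..<r * K}"
      unfolding J_def by (rule pivot_set(1)[OF S])
    fix g :: "nat \<Rightarrow> 'a"
    define \<rho> where "\<rho> w l = (\<Sum>i\<in>{..<K} - {i0, i1}. g (l * K + i) * w i)" for w l
    \<comment> \<open>Subtracting the equations determines the pivot \<open>a l\<close> at
      \<open>i0\<close>; the first equation then gives the pivot \<open>b l\<close> at
      \<open>i1\<close>.\<close>
    define a where "a l = (\<rho> w' l - \<rho> w l) / (w i0 - w' i0)" for l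
    define b where "b l = - \<rho> w l - a l * w i0" for l
    define f0 where "f0 x = (if x \<in> J then if x mod K = i0 then a (x div K) else b (x div K) else 0)"
      for x
    have pivot: "(x \<in> J) = (\<exists>l<r. x = l * K + i0 \<or> x = l * K + i1)" for x
      by (auto simp: J_def)
    have hash: "hash_value K (\<lambda>x. if x \<in> J then f x else g x) v l =
        f (l * K + i0) * v i0 + f (l * K + i1) * v i1 + \<rho> v l" if "l < r" for f v l
      unfolding J_def hash_value_split[OF S that] \<rho>_def using \<open>i0 \<noteq> i1\<close> by simp
    have f0: "f0 (l * K + i0) = a l" "f0 (l * K + i1) = b l" if "l < r" for l
    proof -
      have "l * K + i0 \<in> J" "l * K + i1 \<in> J"
        using that pivot by blast+
      then show "f0 (l * K + i0) = a l" "f0 (l * K + i1) = b l"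
        using \<open>i0 \<noteq> i1\<close> unfolding f0_def
        by (simp_all only: div_mod_mult_add[OF \<open>i0 < K\<close>] div_mod_mult_add[OF \<open>i1 < K\<close>]) auto
    qed
    have solve: "y * w i0 + z + \<rho> w l = 0 \<and> y * w' i0 + z + \<rho> w' l = 0 \<longleftrightarrow> y = a l \<and> z = b l"
      for y z l
    proof
      assume eq: "y * w i0 + z + \<rho> w l = 0 \<and> y * w' i0 + z + \<rho> w' l = 0"
      then have "y * (w i0 - w' i0) = \<rho> w' l - \<rho> w l"
        by (simp add: algebra_simps) (metis add.commute add_left_cancel add.assoc)
      then have "y = a l"
        using assms(2) by (simp add: a_def field_simps)
      moreover from this have "z = b l"
        using eq by (simp add: b_def algebra_simps eq_neg_iff_add_eq_0)
      ultimately show "y = a l \<and> z = b l" ..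
    next
      assume yz: "y = a l \<and> z = b l"
      have "a l * (w i0 - w' i0) = \<rho> w' l - \<rho> w l"
        using assms(2) by (simp add: a_def)
      moreover have "a l * w' i0 + b l + \<rho> w' l = (\<rho> w' l - \<rho> w l) - a l * (w i0 - w' i0)"
        by (simp add: b_def algebra_simps)
      moreover have "a l * w i0 + b l + \<rho> w l = 0"
        by (simp add: b_def)
      ultimately show "y * w i0 + z + \<rho> w l = 0 \<and> y * w' i0 + z + \<rho> w' l = 0"
        using yz by simp
    qed
    show "\<exists>f0. \<forall>f. f \<in> PiE_dflt J 0 (\<lambda>_. UNIV) \<and>
      (\<lambda>x. if x \<in> J then f x else g x) \<in> E \<longleftrightarrow> f = f0"
    proof (intro exI[of _ f0] allI iffI)
      fix f
      assume f: "f \<in> PiE_dflt J 0 (\<lambda>_. UNIV) \<and> (\<lambda>x. if x \<in> J then f x else g x) \<in> E"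
      have eq: "f (l * K + i0) = a l \<and> f (l * K + i1) = b l" if "l < r" for l
      proof -
        have "f (l * K + i0) * w i0 + f (l * K + i1) + \<rho> w l = 0 \<and>
            f (l * K + i0) * w' i0 + f (l * K + i1) + \<rho> w' l = 0"
          using f that hash[OF that, of f w] hash[OF that, of f w'] assms by (simp add: E_def)
        then show ?thesis
          by (simp only: solve)
      qed
      show "f = f0"
      proof
        fix x
        show "f x = f0 x"
        proof (cases "x \<in> J")
          case True
          then show ?thesis
            using eq f0 pivot[of x] by auto
        next
          case False
          then show ?thesis
            using f by (auto simp: PiE_dflt_def f0_def)
        qed
      qed
    next
      fix f assume f: "f = f0"
      have "(\<lambda>x. if x \<in> J then f0 x else g x) \<in> E"
        using solve[of "a _" "b _"] assms by (auto simp: E_def hash f0)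
      moreover have "f0 \<in> PiE_dflt J 0 (\<lambda>_. UNIV)"
        by (simp add: PiE_dflt_def f0_def)
      ultimately show "f \<in> PiE_dflt J 0 (\<lambda>_. UNIV) \<and> (\<lambda>x. if x \<in> J then f x else g x) \<in> E"
        unfolding f by (rule conjI[rotated])
    qed
  qed simp
  then show ?thesis
    using pivot_set(2)[OF S, of r] \<open>i0 \<noteq> i1\<close>
    by (simp add: J_def E_def mult_2_right flip: power_mult)
qed

text \<open>If \<open>X\<close> counts the events that occur, then \<open>Q * X - card W\<close> has
  second moment at most \<open>Q * card W\<close>, while its square is \<open>card W ^ 2\<close>
  whenever no event occurs.\<close>

lemma prob_none_le:
  fixes p :: "'h pmf" and E :: "'w \<Rightarrow> 'h set"
  assumes "finite W" and "W \<noteq> {}" and "0 < Q"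
    and single: "\<And>w. w \<in> W \<Longrightarrow> measure_pmf.prob p (E w) = 1 / Q"
    and pair: "\<And>w w'. w \<in> W \<Longrightarrow> w' \<in> W \<Longrightarrow> w \<noteq> w' \<Longrightarrow>
      measure_pmf.prob p (E w \<inter> E w') = 1 / Q\<^sup>2"
  shows "measure_pmf.prob p {h. \<forall>w\<in>W. h \<notin> E w} \<le> Q / real (card W)"
proof -
  let ?N = "real (card W)"
  have N: "0 < ?N"
    using assms by (simp add: card_gt_0_iff)
  define X :: "'h \<Rightarrow> real" where "X h = (\<Sum>w\<in>W. indicator (E w) h)" for h
  \<comment> \<open>The square is expanded, with \<open>X ^ 2\<close> as a double sum over
    intersections, so that its expectation involves only single and pair probabilities.\<close>
  let ?Y = "\<lambda>h. Q\<^sup>2 * (\<Sum>w\<in>W. \<Sum>w'\<in>W. indicator (E w \<inter> E w') h) - 2 * Q * ?N * X h + ?N\<^sup>2"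
  have Y: "?Y h = (Q * X h - ?N)\<^sup>2" for h
    by (simp add: X_def power2_eq_square sum_product indicator_inter_arith algebra_simps)
  have int: "integrable (measure_pmf p) (indicator A :: 'h \<Rightarrow> real)" for A
    by (simp add: measure_pmf.emeasure_eq_measure less_top[symmetric])
  have sum1: "(\<integral>h. X h \<partial>measure_pmf p) = ?N / Q"
    unfolding X_def by (subst Bochner_Integration.integral_sum) (auto simp: int single)
  \<comment> \<open>The diagonal term contributes \<open>1 / Q\<close> instead of
    \<open>1 / Q ^ 2\<close>.\<close>
  have inner: "(\<Sum>w'\<in>W. measure_pmf.prob p (E w \<inter> E w')) = 1 / Q + (?N - 1) / Q\<^sup>2"
    if "w \<in> W" for w
  proof -
    have "(\<Sum>w'\<in>W. measure_pmf.prob p (E w \<inter> E w')) =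
        measure_pmf.prob p (E w) + (\<Sum>w'\<in>W - {w}. measure_pmf.prob p (E w \<inter> E w'))"
      using that assms(1) by (subst sum.remove) auto
    also have "(\<Sum>w'\<in>W - {w}. measure_pmf.prob p (E w \<inter> E w')) = (\<Sum>w'\<in>W - {w}. 1 / Q\<^sup>2)"
      using that by (intro sum.cong pair) auto
    finally show ?thesis
      using that assms(1) N by (simp add: single card_Diff_singleton of_nat_diff Suc_leI)
  qed
  have sum2: "(\<integral>h. (\<Sum>w\<in>W. \<Sum>w'\<in>W. indicator (E w \<inter> E w') h) \<partial>measure_pmf p) =
      ?N * (1 / Q + (?N - 1) / Q\<^sup>2)"
    by (simp add: Bochner_Integration.integral_sum int inner del: sum_constant cong: sum.cong) simp
  have intX: "integrable (measure_pmf p) X"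
    unfolding X_def by (intro Bochner_Integration.integrable_sum int)
  have intXX: "integrable (measure_pmf p) (\<lambda>h. \<Sum>w\<in>W. \<Sum>w'\<in>W. indicator (E w \<inter> E w') h :: real)"
    by (intro Bochner_Integration.integrable_sum int)
  have "?N\<^sup>2 * measure_pmf.prob p {h. \<forall>w\<in>W. h \<notin> E w} =
      (\<integral>h. ?N\<^sup>2 * indicator {h. \<forall>w\<in>W. h \<notin> E w} h \<partial>measure_pmf p)"
    by simp
  also have "\<dots> \<le> (\<integral>h. ?Y h \<partial>measure_pmf p)"
  proof (rule integral_mono)
    show "integrable (measure_pmf p) ?Y"
      using intX intXX by auto
    show "?N\<^sup>2 * indicator {h. \<forall>w\<in>W. h \<notin> E w} h \<le> ?Y h" for h
      unfolding Y by (auto simp: X_def indicator_def)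
  qed (use int in auto)
  also have "\<dots> = Q\<^sup>2 * (?N * (1 / Q + (?N - 1) / Q\<^sup>2)) - 2 * Q * ?N * (?N / Q) + ?N\<^sup>2"
    using intX intXX by (simp add: sum1 sum2)
  also have "\<dots> = Q * ?N - ?N"
    using \<open>0 < Q\<close> by (simp add: field_simps power2_eq_square)
  also have "\<dots> \<le> Q * ?N"
    by simp
  finally show ?thesis
    using N by (simp add: field_simps power2_eq_square)
qed

text \<open>A word of weight at most \<open>Suc d\<close> arises from one of weight at most
  \<open>d\<close> by resetting one coordinate, with \<open>m\<close> positions and
  \<open>CARD('a)\<close> values to choose from. \<open>0 < m\<close> provides a position for the
  zero word too.\<close>

lemma card_hamming_ball_le:
  assumes "0 < m"
  shows "card {u \<in> carrier_vec m. hamming_weight (u :: 'a :: {field, finite} Matrix.vec) \<le> d} \<le>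
    (CARD('a) * m) ^ d"
proof (induction d)
  case 0
  have "{u \<in> carrier_vec m. hamming_weight (u :: 'a Matrix.vec) \<le> 0} \<subseteq> {0\<^sub>v m}"
    using hamming_weight_eq_0_iff carrier_vecD by (metis (mono_tags, lifting) le_zero_eq
        mem_Collect_eq singletonI subsetI)
  then have "card {u \<in> carrier_vec m. hamming_weight (u :: 'a Matrix.vec) \<le> 0} \<le> card {0\<^sub>v m :: 'a Matrix.vec}"
    by (intro card_mono) auto
  then show ?case
    by simp
next
  case (Suc d)
  let ?B = "\<lambda>d. {u \<in> carrier_vec m. hamming_weight (u :: 'a Matrix.vec) \<le> d}"
  let ?upd = "\<lambda>(u, i, c). Matrix.vec m (\<lambda>j. if j = i then c else vec_index u j :: 'a)"
  have fin: "finite (?B d)" for d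
    by (rule finite_subset[OF _ finite_carrier_vec_finite]) auto
  have "?B (Suc d) \<subseteq> ?upd ` (?B d \<times> {..<m} \<times> UNIV)"
  proof
    fix u assume u: "u \<in> ?B (Suc d)"
    let ?U = "{i. i < m \<and> vec_index u i \<noteq> 0}"
    obtain i where i: "i < m" "card (?U - {i}) \<le> d"
    proof (cases "?U = {}")
      case True
      then have "?U - {0} = {}"
        by blast
      then have "card (?U - {0}) \<le> d"
        by (simp only: card.empty)
      with assms show ?thesis
        by (rule that)
    next
      case False
      then obtain i where "i \<in> ?U"
        by blast
      moreover from this have "card (?U - {i}) = card ?U - 1"
        by (rule card_Diff_singleton)
      ultimately show ?thesis
        using u by (intro that[of i]) (auto simp: hamming_weight_def)
    qed
    let ?v = "Matrix.vec m (\<lambda>j. if j = i then 0 else vec_index u j)"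
    have "{j. j < m \<and> vec_index ?v j \<noteq> 0} = ?U - {i}"
      by (auto split: if_splits)
    then have "?v \<in> ?B d"
      using i(2) by (simp add: hamming_weight_def)
    moreover have "u = ?upd (?v, i, vec_index u i)"
      using u by (intro eq_vecI) auto
    ultimately show "u \<in> ?upd ` (?B d \<times> {..<m} \<times> UNIV)"
      using i(1) by (intro image_eqI[of _ _ "(?v, i, vec_index u i)"]) auto
  qed
  then have "card (?B (Suc d)) \<le> card (?B d \<times> {..<m} \<times> (UNIV :: 'a set))"
    by (rule surj_card_le[rotated]) (auto simp: fin)
  also have "\<dots> = card (?B d) * (CARD('a) * m)"
    by (simp add: card_cartesian_product mult.commute)
  also have "\<dots> \<le> (CARD('a) * m) ^ Suc d"
    using mult_le_mono1[OF Suc] by (simp add: mult.commute)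
  finally show ?case .
qed

section \<open>Success probability\<close>

lemma card_field_ge_2: "2 \<le> CARD('a :: {field, finite})"
proof -
  have "card {0, 1 :: 'a} \<le> CARD('a)"
    by (rule card_mono) auto
  then show ?thesis
    by simp
qed

text \<open>Union bound over the at most \<open>(CARD('a) * m) ^ d\<close> light vectors, each
  passing all checks with probability \<open>1 / CARD('a) ^ r\<close>.\<close>

lemma prob_separating:
  assumes "0 < m" and "100 * (CARD('a) * m) ^ d \<le> CARD('a) ^ r"
  shows "0.99 \<le> measure_pmf.prob (uniform_fun {..<r * (m + m' + 1)})
    {h :: nat \<Rightarrow> 'a :: {field, finite}. separating m m' d r h}"
proof -
  let ?K = "m + m' + 1"
  let ?p = "uniform_fun {..<r * ?K} :: (nat \<Rightarrow> 'a) pmf"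
  define U where "U = {u \<in> carrier_vec m. u \<noteq> 0\<^sub>v m \<and> hamming_weight (u :: 'a Matrix.vec) \<le> d}"
  let ?E = "\<lambda>u. {h. \<forall>l<r. hash_value ?K h (joint_word m m' u (0\<^sub>v m') 0) l = 0}"
  have fin: "finite {u \<in> carrier_vec m. hamming_weight (u :: 'a Matrix.vec) \<le> d}"
    by (rule finite_subset[OF _ finite_carrier_vec_finite]) auto
  then have finU: "finite U"
    by (rule rev_finite_subset) (auto simp: U_def)
  have "card U \<le> card {u \<in> carrier_vec m. hamming_weight (u :: 'a Matrix.vec) \<le> d}"
    using fin by (intro card_mono) (auto simp: U_def)
  also have "\<dots> \<le> (CARD('a) * m) ^ d"
    using \<open>0 < m\<close> by (rule card_hamming_ball_le)
  finally have "100 * card U \<le> CARD('a) ^ r"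
    using assms(2) by linarith
  then have cardU: "100 * real (card U) \<le> real CARD('a) ^ r"
    using of_nat_mono by fastforce
  have "measure_pmf.prob ?p (?E u) = 1 / real CARD('a) ^ r" if u: "u \<in> U" for u
  proof -
    obtain i where "i < m" "vec_index u i \<noteq> 0"
      using u by (auto simp: U_def vec_eq_iff)
    then show ?thesis
      by (intro prob_hash_zero[of i]) (auto simp: joint_word_def)
  qed
  then have "measure_pmf.prob ?p (\<Union>u\<in>U. ?E u) \<le> (\<Sum>u\<in>U. 1 / real CARD('a) ^ r)"
    by (intro order_trans[OF measure_pmf.finite_measure_subadditive_finite[OF finU]] sum_mono) auto
  also have "\<dots> \<le> 1 / 100"
    using cardU by (simp add: field_simps)
  finally have "measure_pmf.prob ?p (\<Union>u\<in>U. ?E u) \<le> 1 / 100" .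
  moreover have "{h. separating m m' d r h} = UNIV - (\<Union>u\<in>U. ?E u)"
    by (auto simp: separating_def U_def)
  ultimately show ?thesis
    using measure_pmf.prob_compl[of "\<Union>u\<in>U. ?E u" ?p] by simp
qed

text \<open>For fixed \<open>u\<close>, the words \<open>(u, v, 1)\<close> differ somewhere in the
  second part and share the entry 1 at position \<open>m + m'\<close>, as
  \<open>prob_hash_zero_pair\<close> requires.\<close>

lemma prob_hit:
  fixes u :: "'a :: {field, finite} Matrix.vec"
  assumes "finite V" and "V \<subseteq> carrier_vec m'" and "100 * CARD('a) ^ r \<le> card V"
  shows "0.99 \<le> measure_pmf.prob (uniform_fun {..<r * (m + m' + 1)})
    {h. \<exists>v\<in>V. \<forall>l<r. hash_value (m + m' + 1) h (joint_word m m' u v 1) l = 0}"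
proof -
  let ?K = "m + m' + 1"
  let ?p = "uniform_fun {..<r * ?K} :: (nat \<Rightarrow> 'a) pmf"
  let ?E = "\<lambda>v. {h. \<forall>l<r. hash_value ?K h (joint_word m m' u v 1) l = 0}"
  let ?Q = "real CARD('a) ^ r"
  have "0 < card V"
    using assms(3) by (rule less_le_trans[rotated]) simp
  have cardV: "100 * ?Q \<le> real (card V)"
    using of_nat_mono[OF assms(3), where 'a = real] by simp
  have "measure_pmf.prob ?p {h. \<forall>v\<in>V. h \<notin> ?E v} \<le> ?Q / real (card V)"
  proof (rule prob_none_le)
    fix v
    show "measure_pmf.prob ?p (?E v) = 1 / ?Q"
      by (intro prob_hash_zero[of "m + m'"]) (auto simp: joint_word_def)
    fix v' assume "v \<in> V" "v' \<in> V" "v \<noteq> v'"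
    then obtain i where i: "i < m'" "vec_index v i \<noteq> vec_index v' i"
      using assms(2) by (metis carrier_vecD eq_vecI subsetD)
    then show "measure_pmf.prob ?p (?E v \<inter> ?E v') = 1 / ?Q\<^sup>2"
      by (intro prob_hash_zero_pair[of "m + i" _ _ _ "m + m'"]) (auto simp: joint_word_def)
  qed (use assms(1) \<open>0 < card V\<close> in auto)
  also have "\<dots> \<le> 1 / 100"
    using cardV \<open>0 < card V\<close> by (simp add: field_simps)
  finally have "measure_pmf.prob ?p {h. \<forall>v\<in>V. h \<notin> ?E v} \<le> 1 / 100" .
  moreover have "{h. \<exists>v\<in>V. h \<in> ?E v} = UNIV - {h. \<forall>v\<in>V. h \<notin> ?E v}"
    by auto
  ultimately show ?thesis
    using measure_pmf.prob_compl[of "{h. \<forall>v\<in>V. h \<notin> ?E v}" ?p] by simp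
qed

section \<open>Parameters of the reduction\<close>

text \<open>Rounding the logarithm up loses at most a factor \<open>q\<close>. The crude estimate
  \<open>m \<le> q ^ m\<close> bounds the number of checks polynomially.\<close>

lemma hash_rank_bounds:
  assumes "2 \<le> q" and "0 < m"
  shows "(q * m) ^ d \<le> q ^ hash_rank q m d" and "q ^ hash_rank q m d \<le> q * (q * m) ^ d"
    and "hash_rank q m d \<le> d * (m + 1)"
proof -
  show "(q * m) ^ d \<le> q ^ hash_rank q m d"
    unfolding hash_rank_def by (rule LeastI_ex) (rule power_ge_exists[OF \<open>2 \<le> q\<close>])
  show "q ^ hash_rank q m d \<le> q * (q * m) ^ d"
  proof (cases "hash_rank q m d")
    case 0
    then show ?thesis
      using assms by simp
  next
    case (Suc j)
    then have "\<not> (q * m) ^ d \<le> q ^ j"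
      unfolding hash_rank_def by (intro not_less_Least) simp
    then show ?thesis
      using Suc by simp
  qed
  have "m \<le> q ^ m"
    using less_exp[of m] power_mono[OF \<open>2 \<le> q\<close>, of m] by linarith
  then have "(q * m) ^ d \<le> (q ^ (m + 1)) ^ d"
    by (intro power_mono) auto
  also have "\<dots> = q ^ (d * (m + 1))"
    by (simp only: power_mult[symmetric] mult.commute)
  finally show "hash_rank q m d \<le> d * (m + 1)"
    unfolding hash_rank_def by (rule Least_le)
qed

text \<open>Two words in the ball force a nonzero codeword, whose weight exceeds \<open>d\<close>
  but not the length; and a ball of radius below 1 holds only the zero word. The first bound serves
  the running time, the second makes the output threshold positive.\<close>

lemma locally_dense_code_bounds:
  assumes ldc: "locally_dense_code \<alpha> d N m n A s" and "2 \<le> N"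
  shows "d < m" and "1 \<le> \<alpha> * real d"
proof -
  let ?S = "(\<lambda>c. c - s) ` code A \<inter> hamming_ball m (\<alpha> * real d)"
  have A: "A \<in> carrier_mat m n" and s: "s \<in> carrier_vec m"
    and dist: "ereal (real d) < min_distance (code A)" and card: "2 \<le> card ?S"
    using assms by (auto simp: locally_dense_code_def)
  have "card ?S \<le> card ((\<lambda>c. c - s) ` code A)"
    using finite_code[OF A] by (intro card_mono) auto
  also have "\<dots> \<le> card (code A)"
    using finite_code[OF A] by (rule card_image_le)
  finally have "2 \<le> card (code A)"
    using card by simp
  then have "\<not> code A \<subseteq> {0\<^sub>v m}"
    using card_mono[of "{0\<^sub>v m}" "code A"] by auto
  then obtain c where c: "c \<in> code A" "c \<noteq> 0\<^sub>v m"
    by auto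
  then have dim: "dim_vec c = m"
    using code_closed[OF A] by auto
  have "hamming_weight c \<le> card {..<m}"
    unfolding hamming_weight_def by (rule card_mono) (auto simp: dim)
  moreover have "min_distance (code A) \<le> ereal (real (hamming_weight c))"
    using c dim by (intro min_distance_le) auto
  with dist have "ereal (real d) < ereal (real (hamming_weight c))"
    by (rule less_le_trans)
  ultimately show "d < m"
    by simp
  show "1 \<le> \<alpha> * real d"
  proof (rule ccontr)
    assume "\<not> 1 \<le> \<alpha> * real d"
    then have "?S \<subseteq> {0\<^sub>v m}"
    proof (intro subsetI)
      fix v assume "\<not> 1 \<le> \<alpha> * real d" "v \<in> ?S"
      then have "v \<in> carrier_vec m" "hamming_weight v = 0"
        by (auto simp: hamming_ball_def)
      then show "v \<in> {0\<^sub>v m}"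
        using hamming_weight_eq_0_iff[of v] by auto
    qed
    then show False
      using card card_mono[of "{0\<^sub>v m}" ?S] by auto
  qed
qed

definition total_time :: "nat \<Rightarrow> nat \<Rightarrow> nat \<Rightarrow> nat \<Rightarrow> nat \<Rightarrow> nat \<Rightarrow> nat" where
  "total_time m n m' n' d r = d * (3 * m + 6) + 6 * r + 10 + (3 * (r * (m + m' + 1)) + 2) +
     reduction.matrix_time m n m' n' d r"

text \<open>\<open>d\<close> and \<open>r\<close> are bounded in terms of \<open>m\<close> and
  \<open>m'\<close>, but the column counts are not, hence the separate linear factor. Every
  contribution is brought to a constant times \<open>S ^ i * L ^ j\<close> with
  \<open>i \<le> 4\<close> and \<open>j \<le> 1\<close>.\<close>

lemma size_bounds:
  fixes m n m' n' d r :: nat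
  assumes "d \<le> m'" and "r \<le> d * (m + 1) + 7"
  defines "T \<equiv> 400 * (1 + m + m') ^ 4 * (n + n' + 1)"
  shows "total_time m n m' n' d r \<le> T" and "m * (m + m' + d * r) \<le> T"
    and "m * (n + n' + 1) \<le> T"
proof -
  define S L where "S = 1 + m + m'" and "L = n + n' + 1"
  have le: "m \<le> S" "m' \<le> S" "m + m' \<le> S" "d \<le> S" "m + 1 \<le> S" "1 \<le> S" "1 \<le> L" "n \<le> L" "n' \<le> L"
    using assms by (auto simp: S_def L_def)
  have r: "r \<le> 8 * S ^ 2"
  proof -
    have "d * (m + 1) + 7 \<le> S * S + 7 * S ^ 2"
      using le by (intro add_mono mult_le_mono) auto
    then show ?thesis
      using assms(2) by (simp add: power2_eq_square)
  qed
  have pow: "S ^ i * L ^ j \<le> S ^ 4 * L" if "i \<le> 4" "j \<le> 1" for i j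
    using that le power_increasing[of i 4 S] power_increasing[of j 1 L] by (intro mult_le_mono) auto
  have R: "m + m' + d * r \<le> 9 * S ^ 3"
  proof -
    have "m + m' + d * r \<le> S ^ 3 + S * (8 * S ^ 2)"
      using le r self_le_power[of S 3] by (intro add_mono mult_le_mono) auto
    then show ?thesis
      by (simp add: power2_eq_square power3_eq_cube)
  qed
  have mR: "m * (m + m' + d * r) \<le> S * (9 * S ^ 3)"
    by (intro mult_le_mono le R)
  have mC: "m * (n + n' + 1) \<le> S * L"
    using le by (intro mult_le_mono) (auto simp: L_def)
  have t1: "d * (3 * m + 6) \<le> S * (9 * S)"
    using le by (intro mult_le_mono) auto
  have t2: "r * (m + m' + 1) \<le> 8 * S ^ 2 * S"
    using r by (intro mult_le_mono) (auto simp: S_def)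
  have t3: "m * (3 * n + 5) \<le> S * (8 * L)" "m' * (3 * n' + 5) \<le> S * (8 * L)"
    using le by (intro mult_le_mono; simp)+
  have C: "3 * (n + n' + 1) + 5 \<le> 8 * L"
    by (simp add: L_def)
  have "(m + m') * (3 * (n + n' + 1) + 5) + 7 \<le> S * (8 * L) + 7 * (S * L)"
    using le by (intro add_mono mult_le_mono C) auto
  then have t4: "r * ((m + m') * (3 * (n + n' + 1) + 5) + 7) + 5 \<le> 8 * S ^ 2 * (15 * (S * L)) + 5 * (S * L)"
    using le r by (intro add_mono mult_le_mono) (auto simp: mult.commute)
  have t5: "d * (r * ((m + m') * (3 * (n + n' + 1) + 5) + 7) + 5) \<le>
      S * (8 * S ^ 2 * (15 * (S * L)) + 5 * (S * L))"
    by (intro mult_le_mono le t4)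
  have "(m + m' + d * r) * (3 * (n + n' + 1) + 5) + 6 \<le> 9 * S ^ 3 * (8 * L) + 6 * L"
    using le by (intro add_mono mult_le_mono C R) auto
  then have t6: "m * ((m + m' + d * r) * (3 * (n + n' + 1) + 5) + 6) \<le>
      S * (9 * S ^ 3 * (8 * L) + 6 * L)"
    by (intro mult_le_mono le)
  have T: "T = 400 * (S ^ 4 * L)"
    by (simp add: T_def S_def L_def)
  show "m * (m + m' + d * r) \<le> T"
  proof -
    note mR
    also have "S * (9 * S ^ 3) = 9 * (S ^ 4 * L ^ 0)"
      by (simp add: power3_eq_cube power4_eq_xxxx)
    also have "\<dots> \<le> T"
      unfolding T by (intro mult_le_mono pow) auto
    finally show ?thesis .
  qed
  have monomials: "S * L = S ^ 1 * L ^ 1" "S * (9 * S) = 9 * (S ^ 2 * L ^ 0)"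
    "8 * S ^ 2 * S = 8 * (S ^ 3 * L ^ 0)" "S * (8 * L) = 8 * (S ^ 1 * L ^ 1)"
    "S * (8 * S ^ 2 * (15 * (S * L)) + 5 * (S * L)) = 120 * (S ^ 4 * L ^ 1) + 5 * (S ^ 2 * L ^ 1)"
    "S * (9 * S ^ 3 * (8 * L) + 6 * L) = 72 * (S ^ 4 * L ^ 1) + 6 * (S ^ 1 * L ^ 1)"
    "8 * S ^ 2 = 8 * (S ^ 2 * L ^ 0)"
    by (simp_all add: power2_eq_square power3_eq_cube power4_eq_xxxx algebra_simps)
  define U where "U = S ^ 4 * L"
  have U: "S ^ i * L ^ j \<le> U" if "i \<le> 4" "j \<le> 1" for i j
    unfolding U_def using that by (rule pow)
  have "1 \<le> U"
    using U[of 0 0] by simp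
  show "m * (n + n' + 1) \<le> T"
    using order_trans[OF mC[unfolded monomials(1)] U] unfolding T by (simp add: U_def)
  have "d * (3 * m + 6) \<le> 9 * U"
    using t1 unfolding monomials(2) by (rule order_trans) (intro mult_le_mono2 U; simp)
  moreover have "r * (m + m' + 1) \<le> 8 * U"
    using t2 unfolding monomials(3) by (rule order_trans) (intro mult_le_mono2 U; simp)
  moreover have "m * (3 * n + 5) \<le> 8 * U"
    using t3(1) unfolding monomials(4) by (rule order_trans) (intro mult_le_mono2 U; simp)
  moreover have "m' * (3 * n' + 5) \<le> 8 * U"
    using t3(2) unfolding monomials(4) by (rule order_trans) (intro mult_le_mono2 U; simp)
  moreover have "d * (r * ((m + m') * (3 * (n + n' + 1) + 5) + 7) + 5) \<le> 120 * U + 5 * U"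
    using t5 unfolding monomials(5) by (rule order_trans) (intro add_mono mult_le_mono2 U; simp)
  moreover have "m * ((m + m' + d * r) * (3 * (n + n' + 1) + 5) + 6) \<le> 72 * U + 6 * U"
    using t6 unfolding monomials(6) by (rule order_trans) (intro add_mono mult_le_mono2 U; simp)
  moreover have "r \<le> 8 * U"
    using r unfolding monomials(7) by (rule order_trans) (intro mult_le_mono2 U; simp)
  \<comment> \<open>The coefficients, with additive constants absorbed by \<open>1 \<le> U\<close>,
    add up to 326.\<close>
  ultimately show "total_time m n m' n' d r \<le> T"
    using \<open>1 \<le> U\<close> unfolding T total_time_def reduction.matrix_time_def U_def[symmetric]
    by linarith
qed

section \<open>Correctness of the reduction\<close>

text \<open>All phases but the draws are deterministic, so the final distribution is the image of
  the uniform \<open>h\<close> under a function.\<close>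

lemma run_reduction_prog:
  fixes G A :: "'a :: {field, finite} mat" and \<gamma> \<alpha> :: real and k q m n m' n' :: nat
  assumes "2 \<le> q" and "0 < m"
    and "G \<in> carrier_mat m n" and "A \<in> carrier_mat m' n'"
  defines "d \<equiv> nat \<lfloor>\<gamma> * real k\<rfloor>"
  defines "r \<equiv> hash_rank q m d + 7"
  obtains final :: "(nat \<Rightarrow> 'a) \<Rightarrow> 'a store" where
    "\<And>T. total_time m n m' n' d r \<le> T \<Longrightarrow>
      run (reduction_prog \<gamma> \<alpha> q) T (input_store G t k A s) =
      map_pmf (\<lambda>h. ([], final h)) (uniform_fun {..<r * (m + m' + 1)})"
    and "\<And>h. output_mat (final h) = reduction.out_mat m n m' n' d r
      (mat_entries G) (vec_entries t) (mat_entries A) (vec_entries s) h"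
    and "\<And>h. output_k (final h) = nat \<lfloor>\<alpha> * real d\<rfloor> + k - 1"
proof -
  let ?\<sigma> = "input_store G t k A s"
  let ?Z = "r * (m + m' + 1)"
  let ?T1 = "d * (3 * m + 6) + 6 * r + 10"
  let ?T3 = "reduction.matrix_time m n m' n' d r"
  have dims: "dims m n k m' n' ?\<sigma>"
    using assms(3,4) by (auto simp: dims_def input_store_def)
  obtain T1 \<sigma>1 where T1: "T1 \<le> ?T1" "\<And>R. steps T1 (params_prog \<gamma> q @ R, ?\<sigma>) = return_pmf (R, \<sigma>1)"
    and \<sigma>1: "dims m n k m' n' \<sigma>1" "arr \<sigma>1 = arr ?\<sigma>" "num \<sigma>1 ''d'' = d" "num \<sigma>1 ''r'' = r"
      "num \<sigma>1 ''Z'' = ?Z"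
    using reach_params_prog[OF \<open>2 \<le> q\<close> dims, of \<gamma>] unfolding reach_def d_def r_def by blast
  define \<sigma>2 where "\<sigma>2 h = put_random h (set_num ''z'' ?Z \<sigma>1)" for h
  have T2: "steps (3 * ?Z + 2) (draw_loop @ R, \<sigma>1) = map_pmf (\<lambda>h. (R, \<sigma>2 h)) (uniform_fun {..<?Z})" for R
    using steps_draw_loop[of \<sigma>1 R] \<sigma>1(2,5) by (simp add: \<sigma>2_def input_store_def)
  let ?out = "\<lambda>h. reduction.out_upto m n m' n' d r (mat_entries G) (vec_entries t)
    (mat_entries A) (vec_entries s) h m 0 0"
  let ?post = "\<lambda>h \<sigma>'. arr \<sigma>' ''out'' = ?out h \<and> num \<sigma>' ''rows'' = m * (m + m' + d * r) \<and>
    num \<sigma>' ''cols'' = m * (n + n' + 1) \<and> num \<sigma>' ''k_out'' = nat \<lfloor>\<alpha> * real d\<rfloor> + k - 1"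
  have "reach (matrix_prog \<alpha>) (\<sigma>2 h) ?T3 (?post h)" for h
  proof (rule reduction.reach_matrix_prog)
    show "reduction.ctx m n k m' n' d r (mat_entries G) (vec_entries t) (mat_entries A)
        (vec_entries s) h (\<sigma>2 h)"
      using \<sigma>1 by (auto simp: reduction.ctx_def \<sigma>2_def dims_def input_store_def)
  qed (use \<sigma>1(2) \<open>0 < m\<close> in \<open>auto simp: \<sigma>2_def input_store_def\<close>)
  then have "\<forall>h. \<exists>\<sigma>'. ?post h \<sigma>' \<and>
      (\<exists>T\<le>?T3. \<forall>R. steps T (matrix_prog \<alpha> @ R, \<sigma>2 h) = return_pmf (R, \<sigma>'))"
    unfolding reach_def by blast
  then obtain final where final: "\<And>h. ?post h (final h)"
    and T3: "\<And>h. \<exists>T\<le>?T3. \<forall>R. steps T (matrix_prog \<alpha> @ R, \<sigma>2 h) = return_pmf (R, final h)"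
    by metis
  \<comment> \<open>The time needed after the draws may depend on \<open>h\<close>; padding with
    halted steps gives one \<open>T\<close> for all \<open>h\<close>.\<close>
  have halt: "steps T (matrix_prog \<alpha>, \<sigma>2 h) = return_pmf ([], final h)" if "?T3 \<le> T" for T h
  proof -
    obtain T' where T': "T' \<le> ?T3" "\<And>R. steps T' (matrix_prog \<alpha> @ R, \<sigma>2 h) = return_pmf (R, final h)"
      using T3 by blast
    have "steps T' (matrix_prog \<alpha>, \<sigma>2 h) = return_pmf ([], final h)"
      using T'(2)[of "[]"] by simp
    then have "steps (T' + (T - T')) (matrix_prog \<alpha>, \<sigma>2 h) = return_pmf ([], final h)"
      by (simp only: steps_add bind_return_pmf steps_halted)
    then show ?thesis
      using T'(1) that by simp
  qed
  show thesis
  proof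
    fix T assume T: "total_time m n m' n' d r \<le> T"
    define T' where "T' = T - T1 - (3 * ?Z + 2)"
    have T': "T = T1 + ((3 * ?Z + 2) + T')" "?T3 \<le> T'"
      using T T1(1) by (auto simp: T'_def total_time_def)
    have "run (reduction_prog \<gamma> \<alpha> q) T ?\<sigma> =
        bind_pmf (uniform_fun {..<?Z}) (\<lambda>h. steps T' (matrix_prog \<alpha>, \<sigma>2 h))"
      unfolding run_eq_steps reduction_prog_def T'(1)
      by (simp only: steps_add[of T1] T1(2) bind_return_pmf steps_add[of "3 * ?Z + 2"] T2 bind_map_pmf)
    then show "run (reduction_prog \<gamma> \<alpha> q) T ?\<sigma> =
        map_pmf (\<lambda>h. ([], final h)) (uniform_fun {..<?Z})"
      by (simp add: halt[OF T'(2)] map_pmf_def)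
  next
    show "output_mat (final h) = reduction.out_mat m n m' n' d r (mat_entries G) (vec_entries t)
        (mat_entries A) (vec_entries s) h" for h
      using final[of h] by (simp add: output_mat_def reduction.out_mat_def)
    show "output_k (final h) = nat \<lfloor>\<alpha> * real d\<rfloor> + k - 1" for h
      using final[of h] by (simp add: output_k_def)
  qed
qed

lemma code_dist_attained:
  fixes G :: "'a :: {field, finite} mat"
  assumes "G \<in> carrier_mat m n"
  obtains x where "x \<in> carrier_vec n" and "code_dist t (code G) = hamming_weight (t - G *\<^sub>v x)"
proof -
  have "G *\<^sub>v 0\<^sub>v (dim_col G) \<in> code G"
    unfolding code_def by (rule CollectI, rule exI, rule conjI, rule refl, rule zero_carrier_vec)
  then have "code G \<noteq> {}"
    by blast
  then have "code_dist t (code G) \<in> (\<lambda>c. hamming_weight (t - c)) ` code G"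
    using finite_code[OF assms] unfolding code_dist_def by (intro Min_in) auto
  then show ?thesis
    using that assms by (auto simp: code_def)
qed

text \<open>Since \<open>t\<close> and \<open>s\<close> enter the matrix with positive sign, the NCP
  solution and the ball words are negated. The zero word is removed from the ball to keep the
  codeword nonzero, which accounts for the additional 1 required of \<open>N\<close>.\<close>

lemma prob_yes:
  fixes G A :: "'a :: {field, finite} mat"
  assumes "0 < m" and inst: "ncp_instance m n G t k" and ldc: "locally_dense_code \<alpha> d N m' n' A s"
    and yes: "ncp_yes G t k" and "1 + 100 * CARD('a) ^ r \<le> N"
  shows "0.99 \<le> measure_pmf.prob (uniform_fun {..<r * (m + m' + 1)})
    {h. mdp_yes (reduction.out_mat m n m' n' d r (mat_entries G) (vec_entries t) (mat_entries A)
      (vec_entries s) h) (nat \<lfloor>\<alpha> * real d\<rfloor> + k - 1)}"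
proof -
  have G: "G \<in> carrier_mat m n" and t: "t \<in> carrier_vec m" and "0 < k"
    using inst by (auto simp: ncp_instance_def)
  have A: "A \<in> carrier_mat m' n'" and s: "s \<in> carrier_vec m'"
    and card: "N \<le> card ((\<lambda>c. c - s) ` code A \<inter> hamming_ball m' (\<alpha> * real d))" and "0 < \<alpha>"
    using ldc by (auto simp: locally_dense_code_def)
  obtain x where x: "x \<in> carrier_vec n" "hamming_weight (t - G *\<^sub>v x) \<le> k"
    using code_dist_attained[OF G] yes unfolding ncp_yes_def by metis
  define u where "u = G *\<^sub>v (- x) + t"
  have "u = t - G *\<^sub>v x"
    unfolding u_def using G t x(1) by (intro eq_vecI) auto
  then have wt_u: "hamming_weight u \<le> k"
    using x(2) by simp
  define S where "S = (\<lambda>c. c - s) ` code A \<inter> hamming_ball m' (\<alpha> * real d) - {0\<^sub>v m'}"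
  define V where "V = uminus ` S"
  have finS: "finite S"
    using finite_code[OF A] by (simp add: S_def)
  have S_carrier: "S \<subseteq> carrier_vec m'"
    by (auto simp: S_def hamming_ball_def)
  have V: "\<exists>y. y \<in> carrier_vec n' \<and> v = A *\<^sub>v y + s \<and> v \<noteq> 0\<^sub>v m' \<and>
      hamming_weight v \<le> nat \<lfloor>\<alpha> * real d\<rfloor>" if v: "v \<in> V" for v
  proof -
    obtain w where w: "w \<in> S" "v = - w"
      using v by (auto simp: V_def)
    then obtain c where "c \<in> code A" "w = c - s"
      by (auto simp: S_def)
    then obtain y where "y \<in> carrier_vec n'" "w = A *\<^sub>v y - s"
      using A by (auto simp: code_def)
    with w have y: "y \<in> carrier_vec n'" "v = - (A *\<^sub>v y - s)" "A *\<^sub>v y - s \<noteq> 0\<^sub>v m'"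
        "real (hamming_weight (A *\<^sub>v y - s)) \<le> \<alpha> * real d"
      by (auto simp: S_def hamming_ball_def)
    have "v = A *\<^sub>v (- y) + s"
      unfolding y(2) using A s y(1) by (intro eq_vecI) auto
    moreover have "v \<noteq> 0\<^sub>v m'"
      using y(2,3) by (metis uminus_uminus_vec uminus_zero_vec)
    moreover have "hamming_weight v \<le> nat \<lfloor>\<alpha> * real d\<rfloor>"
      using y(2,4) by (simp add: le_nat_floor)
    ultimately show ?thesis
      using y(1) by (intro exI[of _ "- y"]) auto
  qed
  have "card V = card S"
    unfolding V_def by (intro card_image inj_onI) (metis uminus_uminus_vec)
  moreover have "N \<le> card S + 1"
    using card diff_card_le_card_Diff[of "{0\<^sub>v m'}" "(\<lambda>c. c - s) ` code A \<inter> hamming_ball m' (\<alpha> * real d)"]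
    by (simp add: S_def)
  ultimately have "100 * CARD('a) ^ r \<le> card V"
    using assms(5) by linarith
  moreover have "V \<subseteq> carrier_vec m'"
    using S_carrier by (auto simp: V_def)
  moreover have "finite V"
    using finS by (simp add: V_def)
  ultimately have "0.99 \<le> measure_pmf.prob (uniform_fun {..<r * (m + m' + 1)})
      {h. \<exists>v\<in>V. \<forall>l<r. hash_value (m + m' + 1) h (joint_word m m' u v 1) l = 0}"
    by (intro prob_hit)
  also have "\<dots> \<le> measure_pmf.prob (uniform_fun {..<r * (m + m' + 1)})
    {h. mdp_yes (reduction.out_mat m n m' n' d r (mat_entries G) (vec_entries t) (mat_entries A)
      (vec_entries s) h) (nat \<lfloor>\<alpha> * real d\<rfloor> + k - 1)}"
  proof (intro measure_pmf.finite_measure_mono subsetI CollectI)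
    fix h assume "h \<in> {h. \<exists>v\<in>V. \<forall>l<r. hash_value (m + m' + 1) h (joint_word m m' u v 1) l = 0}"
    then obtain v where v: "v \<in> V"
        "\<And>l. l < r \<Longrightarrow> hash_value (m + m' + 1) h (joint_word m m' u v 1) l = 0"
      by blast
    obtain y where y: "y \<in> carrier_vec n'" "v = A *\<^sub>v y + s" "v \<noteq> 0\<^sub>v m'"
        "hamming_weight v \<le> nat \<lfloor>\<alpha> * real d\<rfloor>"
      using V[OF v(1)] by blast
    have "matrix_reduction m n m' n' G t A s"
      by standard (fact G t A s)+
    then have "min_distance (code (reduction.out_mat m n m' n' d r (mat_entries G) (vec_entries t)
        (mat_entries A) (vec_entries s) h)) \<le> ereal (real (k - 1 + hamming_weight v))"
      by (rule matrix_reduction.min_distance_out_le[OF _ \<open>0 < m\<close> _ y(1) u_def y(2,3) wt_u \<open>0 < k\<close> v(2)])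
         (use x(1) in auto)
    also have "\<dots> \<le> ereal (real (nat \<lfloor>\<alpha> * real d\<rfloor> + k - 1))"
      using y(4) \<open>0 < k\<close> by simp
    finally show "mdp_yes (reduction.out_mat m n m' n' d r (mat_entries G) (vec_entries t)
        (mat_entries A) (vec_entries s) h) (nat \<lfloor>\<alpha> * real d\<rfloor> + k - 1)"
      by (simp add: mdp_yes_def)
  qed auto
  finally show ?thesis .
qed

lemma prob_no:
  fixes G A :: "'a :: {field, finite} mat"
  assumes "0 < m" and inst: "ncp_instance m n G t k" and ldc: "locally_dense_code \<alpha> d N m' n' A s"
    and no: "ncp_no \<gamma> G t k" and "real d = \<gamma> * real k"
    and "100 * (CARD('a) * m) ^ d \<le> CARD('a) ^ r" and "\<gamma>' * real k' < real d"
  shows "0.99 \<le> measure_pmf.prob (uniform_fun {..<r * (m + m' + 1)})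
    {h. mdp_no \<gamma>' (reduction.out_mat m n m' n' d r (mat_entries G) (vec_entries t) (mat_entries A)
      (vec_entries s) h) k'}"
proof -
  have red: "matrix_reduction m n m' n' G t A s"
    using inst ldc by (auto simp: matrix_reduction_def ncp_instance_def locally_dense_code_def)
  have dist: "d < code_dist t (code G)" "ereal (real d) < min_distance (code A)"
    using no ldc \<open>real d = \<gamma> * real k\<close> by (auto simp: ncp_no_def locally_dense_code_def)
  have "0.99 \<le> measure_pmf.prob (uniform_fun {..<r * (m + m' + 1)})
      {h :: nat \<Rightarrow> 'a. separating m m' d r h}"
    by (rule prob_separating) fact+
  also have "\<dots> \<le> measure_pmf.prob (uniform_fun {..<r * (m + m' + 1)})
    {h. mdp_no \<gamma>' (reduction.out_mat m n m' n' d r (mat_entries G) (vec_entries t) (mat_entries A)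
      (vec_entries s) h) k'}"
  proof (intro measure_pmf.finite_measure_mono subsetI CollectI)
    fix h :: "nat \<Rightarrow> 'a" assume "h \<in> {h. separating m m' d r h}"
    then have "ereal (real d) \<le> min_distance (code (reduction.out_mat m n m' n' d r (mat_entries G)
        (vec_entries t) (mat_entries A) (vec_entries s) h))"
      by (intro matrix_reduction.min_distance_out_ge[OF red dist]) simp
    moreover have "ereal (\<gamma>' * real k') < ereal (real d)"
      using assms(7) by simp
    ultimately show "mdp_no \<gamma>' (reduction.out_mat m n m' n' d r (mat_entries G) (vec_entries t)
        (mat_entries A) (vec_entries s) h) k'"
      unfolding mdp_no_def by (rule less_le_trans[rotated])
  qed auto
  finally show ?thesis .
qed

text \<open>\<open>k'\<close> is at most \<open>(1 + \<alpha> * \<gamma>) * k - 1\<close>.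
  Multiplied by \<open>\<gamma>'\<close>, the first term is at most \<open>\<gamma> * k\<close>, and
  the subtracted \<open>\<gamma>'\<close> makes the bound strict.\<close>

lemma output_threshold:
  fixes \<gamma> \<gamma>' \<alpha> :: real
  assumes "\<gamma> \<ge> 1" and "\<gamma>' \<ge> 1" and "0 < \<alpha>" and "\<gamma>' \<le> \<gamma> / (1 + \<alpha> * \<gamma>)"
    and "0 < k" and "real d = \<gamma> * real k" and "1 \<le> \<alpha> * real d"
  defines "k' \<equiv> nat \<lfloor>\<alpha> * real d\<rfloor> + k - 1"
  shows "0 < k'" and "real k' < \<gamma> * real k" and "\<gamma>' * real k' < real d"
proof -
  have "1 \<le> \<lfloor>\<alpha> * real d\<rfloor>"
    using assms(7) by linarith
  then have "nat 1 \<le> nat \<lfloor>\<alpha> * real d\<rfloor>"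
    by (rule nat_mono)
  then show "0 < k'"
    using \<open>0 < k\<close> unfolding k'_def nat_1 by linarith
  have "real (nat \<lfloor>\<alpha> * real d\<rfloor>) \<le> \<alpha> * real d"
    using assms(7) by (intro of_nat_floor) simp
  then have k': "real k' \<le> (1 + \<alpha> * \<gamma>) * real k - 1"
    using \<open>0 < k\<close> assms(6) by (simp add: k'_def of_nat_diff algebra_simps)
  have "0 < 1 + \<alpha> * \<gamma>"
    using assms(1,3) by (simp add: add_pos_nonneg)
  then have \<gamma>: "\<gamma>' * (1 + \<alpha> * \<gamma>) \<le> \<gamma>"
    using assms(4) by (simp add: pos_le_divide_eq)
  have "\<gamma>' * real k' \<le> \<gamma>' * ((1 + \<alpha> * \<gamma>) * real k - 1)"
    using k' assms(2) by (intro mult_left_mono) auto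
  also have "\<dots> = \<gamma>' * (1 + \<alpha> * \<gamma>) * real k - \<gamma>'"
    by (simp add: algebra_simps)
  also have "\<dots> \<le> \<gamma> * real k - \<gamma>'"
    using \<gamma> by (intro diff_right_mono mult_right_mono) auto
  also have "\<dots> < \<gamma> * real k"
    using assms(2) by simp
  finally have lt: "\<gamma>' * real k' < \<gamma> * real k" .
  then show "\<gamma>' * real k' < real d"
    using assms(6) by simp
  have "real k' \<le> \<gamma>' * real k'"
    using assms(2) by (simp add: mult_right_mono[of 1 \<gamma>', simplified])
  then show "real k' < \<gamma> * real k"
    using lt by linarith
qed

theorem theorem3p1:
  fixes q :: nat and \<gamma> \<gamma>' \<alpha> :: real
  assumes "q = CARD('a :: {field, finite})"
    and "\<gamma> \<ge> 1" and "\<gamma>' \<ge> 1" and "0 < \<alpha>" and "\<alpha> < 1"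
    and "\<gamma>' \<le> \<gamma> / (1 + \<alpha> * \<gamma>)"
  shows "\<exists>(P :: 'a program) (p :: nat poly) m\<^sub>0.
    scalars_of P \<subseteq> {\<gamma>, \<gamma>', \<alpha>} \<and>
    (\<forall>m n m' n' d N k (G :: 'a mat) t (A :: 'a mat) s.
       m \<ge> m\<^sub>0 \<longrightarrow>
       ncp_instance m n G t k \<longrightarrow>
       locally_dense_code \<alpha> d N m' n' A s \<longrightarrow>
       real d = \<gamma> * real k \<longrightarrow>
       N \<ge> 100 * q ^ 10 * (q * m) ^ d \<longrightarrow>
       (let T = poly p (m + m') * (n + n' + 1);
            \<sigma>\<^sub>0 = input_store G t k A s
        in outputs_within P T \<sigma>\<^sub>0 \<and>
           (\<forall>(R, \<sigma>) \<in> set_pmf (run P T \<sigma>\<^sub>0).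
              0 < output_k \<sigma> \<and> real (output_k \<sigma>) < \<gamma> * real k) \<and>
           measure_pmf.prob (run P T \<sigma>\<^sub>0)
             {(R, \<sigma>).
                (ncp_yes G t k \<longrightarrow> mdp_yes (output_mat \<sigma>) (output_k \<sigma>)) \<and>
                (ncp_no \<gamma> G t k \<longrightarrow> mdp_no \<gamma>' (output_mat \<sigma>) (output_k \<sigma>))}
             \<ge> 0.99))"
proof (intro exI[of _ "reduction_prog \<gamma> \<alpha> q :: 'a program"] exI[of _ "[:400:] * [:1, 1:] ^ 4 :: nat poly"]
    exI[of _ "1 :: nat"] conjI allI impI)
  show "scalars_of (reduction_prog \<gamma> \<alpha> q :: 'a program) \<subseteq> {\<gamma>, \<gamma>', \<alpha>}"
    using scalars_reduction_prog by blast
next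
  fix m n m' n' d N k and G A :: "'a mat" and t s
  assume "1 \<le> m" and inst: "ncp_instance m n G t k" and ldc: "locally_dense_code \<alpha> d N m' n' A s"
    and d: "real d = \<gamma> * real k" and N: "100 * q ^ 10 * (q * m) ^ d \<le> N"
  have "0 < m" and "2 \<le> q" and G: "G \<in> carrier_mat m n" and "0 < k" and A: "A \<in> carrier_mat m' n'"
    using \<open>1 \<le> m\<close> card_field_ge_2[where 'a = 'a] assms(1) inst ldc
    by (auto simp: ncp_instance_def locally_dense_code_def)
  define r where "r = hash_rank q m d + 7"
  define k' where "k' = nat \<lfloor>\<alpha> * real d\<rfloor> + k - 1"
  define T where "T = 400 * (1 + m + m') ^ 4 * (n + n' + 1)"
  \<comment> \<open>The program has \<open>\<gamma>\<close> only under a floor, which is exact here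
    because \<open>\<gamma> * k\<close> is the integer \<open>d\<close>.\<close>
  have floor_d: "nat \<lfloor>\<gamma> * real k\<rfloor> = d"
    by (simp flip: d)
  \<comment> \<open>Seven additional checks suffice because \<open>q ^ 7\<close> is at least
    128.\<close>
  have "2 ^ 7 \<le> q ^ 7"
    using \<open>2 \<le> q\<close> by (rule power_mono) simp
  then have lower: "100 * (q * m) ^ d \<le> q ^ r"
    using mult_le_mono[OF _ hash_rank_bounds(1)[OF \<open>2 \<le> q\<close> \<open>0 < m\<close>, of d], of 100 "q ^ 7"]
    by (simp add: r_def power_add mult.commute)
  \<comment> \<open>Of the factor \<open>q ^ 10\<close>, the seven additional checks use
    \<open>q ^ 7\<close>, rounding up the logarithm uses \<open>q\<close>, and the remaining
    \<open>q ^ 2 \<ge> 4\<close> absorbs the additional 1.\<close>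
  have upper: "1 + 100 * q ^ r \<le> N"
  proof -
    have "q ^ r \<le> q ^ 8 * (q * m) ^ d"
      using mult_le_mono2[OF hash_rank_bounds(2)[OF \<open>2 \<le> q\<close> \<open>0 < m\<close>, of d], of "q ^ 7"]
      by (simp add: r_def power_add eval_nat_numeral algebra_simps)
    moreover have "1 \<le> q ^ 8 * (q * m) ^ d"
      using \<open>2 \<le> q\<close> \<open>0 < m\<close> by (simp add: Suc_le_eq)
    ultimately have "1 + 100 * q ^ r \<le> 101 * (q ^ 8 * (q * m) ^ d)"
      by linarith
    also have "\<dots> \<le> 100 * (4 * (q ^ 8 * (q * m) ^ d))"
      by simp
    also have "\<dots> \<le> 100 * (q ^ 2 * (q ^ 8 * (q * m) ^ d))"
      using power_mono[OF \<open>2 \<le> q\<close>, of 2] by (intro mult_le_mono2 mult_le_mono1) simp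
    also have "\<dots> = 100 * q ^ 10 * (q * m) ^ d"
      by (simp add: mult.assoc flip: power_add)
    finally show ?thesis
      using N by simp
  qed
  have "1 \<le> q ^ r"
    using \<open>2 \<le> q\<close> by simp
  with upper have "2 \<le> N"
    by linarith
  note ldc_bounds = locally_dense_code_bounds[OF ldc this]
  note k'_bounds = output_threshold[OF assms(2-4,6) \<open>0 < k\<close> d ldc_bounds(2), folded k'_def]
  have sizes: "total_time m n m' n' d r \<le> T" "m * (m + m' + d * r) \<le> T" "m * (n + n' + 1) \<le> T"
    unfolding T_def
    using size_bounds[of d m' r m n n'] ldc_bounds(1) hash_rank_bounds(3)[OF \<open>2 \<le> q\<close> \<open>0 < m\<close>, of d]
    by (auto simp: r_def)
  let ?P = "reduction_prog \<gamma> \<alpha> q :: 'a program"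
  let ?\<sigma> = "input_store G t k A s"
  let ?h = "uniform_fun {..<r * (m + m' + 1)} :: (nat \<Rightarrow> 'a) pmf"
  let ?M = "reduction.out_mat m n m' n' d r (mat_entries G) (vec_entries t) (mat_entries A) (vec_entries s)"
  obtain final where run: "run ?P T ?\<sigma> = map_pmf (\<lambda>h. ([], final h)) ?h"
    and final: "\<And>h. output_mat (final h) = ?M h" "\<And>h. output_k (final h) = k'"
    using run_reduction_prog[OF \<open>2 \<le> q\<close> \<open>0 < m\<close> G A, of \<gamma> k \<alpha> t s] sizes(1)
    unfolding floor_d r_def k'_def by metis
  let ?good = "{h. (ncp_yes G t k \<longrightarrow> mdp_yes (?M h) k') \<and> (ncp_no \<gamma> G t k \<longrightarrow> mdp_no \<gamma>' (?M h) k')}"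
  have "0.99 \<le> measure_pmf.prob ?h ?good"
  proof -
    \<comment> \<open>The two promises exclude each other, so at most one of the two probability
      estimates is needed for a given instance and their errors do not add up.\<close>
    have "\<not> ncp_no \<gamma> G t k" if "ncp_yes G t k"
    proof -
      have "real (code_dist t (code G)) \<le> 1 * real k"
        using that by (simp add: ncp_yes_def)
      also have "\<dots> \<le> \<gamma> * real k"
        using assms(2) by (intro mult_right_mono) auto
      finally show ?thesis
        by (simp add: ncp_no_def)
    qed
    then consider "ncp_yes G t k" "\<not> ncp_no \<gamma> G t k" | "\<not> ncp_yes G t k" "ncp_no \<gamma> G t k" |
      "\<not> ncp_yes G t k" "\<not> ncp_no \<gamma> G t k"
      by blast
    then show ?thesis
    proof cases
      case 1
      then show ?thesis
        using prob_yes[OF \<open>0 < m\<close> inst ldc _ upper[unfolded assms(1)]] by (simp add: k'_def)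
    next
      case 2
      then show ?thesis
        using prob_no[OF \<open>0 < m\<close> inst ldc _ d lower[unfolded assms(1)] k'_bounds(3)] by simp
    qed simp
  qed
  moreover have "outputs_within ?P T ?\<sigma>"
    using sizes(2,3) by (auto simp: outputs_within_def run final reduction.out_mat_def)
  moreover have "poly ([:400:] * [:1, 1:] ^ 4) (m + m') * (n + n' + 1) = T"
    by (simp add: T_def poly_power add.assoc)
  ultimately show "let T = poly ([:400:] * [:1, 1:] ^ 4) (m + m') * (n + n' + 1);
            \<sigma>\<^sub>0 = input_store G t k A s
        in outputs_within ?P T \<sigma>\<^sub>0 \<and>
           (\<forall>(R, \<sigma>) \<in> set_pmf (run ?P T \<sigma>\<^sub>0).
              0 < output_k \<sigma> \<and> real (output_k \<sigma>) < \<gamma> * real k) \<and>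
           measure_pmf.prob (run ?P T \<sigma>\<^sub>0)
             {(R, \<sigma>).
                (ncp_yes G t k \<longrightarrow> mdp_yes (output_mat \<sigma>) (output_k \<sigma>)) \<and>
                (ncp_no \<gamma> G t k \<longrightarrow> mdp_no \<gamma>' (output_mat \<sigma>) (output_k \<sigma>))}
             \<ge> 0.99"
    unfolding Let_def using k'_bounds(1,2)
    by (auto simp: run final vimage_def)
qed

end
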